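(* For all integers $T,p,R\ge1$, \[ \gamma_2(\mathcal S^{Tp-1},\|\cdot\|_\ominus)\lesssim\sqrt{T\tilde p},\qquad\text{where }\tilde p:=p\min\{T,\log^2(eTp)\log^2(eT)\}, \] with $\mathcal S^{Tp-1}$ the unit Euclidean sphere of $\mathbb R^{Tp}$.
   Context: For $\bar v=[v_1^\top,\dots,v_T^\top]^\top\in\mathbb R^{Tp}$ ($v_i\in\mathbb R^p$) and $R\ge1$, let $\mathsf{Toep}_T(\bar v)$ be the $R\times(R+T-1)$ block matrix with $1\times p$ blocks whose $i$-th block row has $v_T^\top,v_{T-1}^\top,\dots,v_1^\top$ in block columns $i,i+1,\dots,i+T-1$ and zeros elsewhere (so the $k$-th block superdiagonal equals $v_{T-k}^\top$, $0\le k\le T-1$). Define the norm $\|\bar v\|_\ominus:=\|\mathsf{Toep}_T(\bar v)\|_{\mathrm{op}}$. Talagrand's functional: $\gamma_2(\mathcal X,\mathsf d):=\inf_{(\mathcal A_n)}\sup_{x\in\mathcal X}\sum_{n\ge0}2^{n/2}\mathsf{diam}(\mathcal A_n(x))$ over partition sequences with $|\mathcal A_0|=1$, $|\mathcal A_n|\le2^{2^n}$. $\lesssim$ hides a universal constant. *)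

theory Defs
  imports "HOL-Analysis.Analysis"
begin

text \<open>Vectors of R^(T p) are functions nat => real supported on {0..<T*p}.
  Block i (1-based, 1 <= i <= T) of vbar is v_i = (vbar((i-1)*p + j))_{j<p}.\<close>

definition unit_sphere :: "nat \<Rightarrow> (nat \<Rightarrow> real) set" where
  "unit_sphere N = {v. (\<forall>k\<ge>N. v k = 0) \<and> (\<Sum>k<N. (v k)^2) = 1}"

text \<open>Entry (r, c*p+j) of the R x (R+T-1)p block Toeplitz matrix (0-based r, c, j):
  block (r,c) equals v_T-(c-r) transposed when r <= c <= r+T-1, zero otherwise.\<close>
definition toep_entry :: "nat \<Rightarrow> nat \<Rightarrow> (nat \<Rightarrow> real) \<Rightarrow> nat \<Rightarrow> nat \<Rightarrow> real" where
  "toep_entry T p vbar r k =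
     (let c = k div p; j = k mod p in
      if r \<le> c \<and> c < r + T then vbar ((T - 1 - (c - r)) * p + j) else 0)"

definition op_norm :: "nat \<Rightarrow> nat \<Rightarrow> (nat \<Rightarrow> nat \<Rightarrow> real) \<Rightarrow> real" where
  "op_norm m n M = Sup {sqrt (\<Sum>r<m. (\<Sum>k<n. M r k * x k)^2) | x. (\<Sum>k<n. (x k)^2) \<le> 1}"

definition toep_norm :: "nat \<Rightarrow> nat \<Rightarrow> nat \<Rightarrow> (nat \<Rightarrow> real) \<Rightarrow> real" where
  "toep_norm T p R vbar = op_norm R ((R + T - 1) * p) (toep_entry T p vbar)"

definition diam_d :: "('a \<Rightarrow> 'a \<Rightarrow> real) \<Rightarrow> 'a set \<Rightarrow> real" where
  "diam_d d B = Sup {d x y | x y. x \<in> B \<and> y \<in> B}"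

definition is_partition :: "'a set \<Rightarrow> 'a set set \<Rightarrow> bool" where
  "is_partition X P \<longleftrightarrow> (\<forall>B\<in>P. B \<noteq> {} \<and> B \<subseteq> X) \<and> (\<forall>x\<in>X. \<exists>!B. B \<in> P \<and> x \<in> B)"

definition admissible :: "'a set \<Rightarrow> (nat \<Rightarrow> 'a set set) \<Rightarrow> bool" where
  "admissible X A \<longleftrightarrow>
     (\<forall>n. is_partition X (A n) \<and> finite (A n) \<and> card (A n) \<le> 2 ^ (2 ^ n)) \<and>
     card (A 0) = 1 \<and>
     (\<forall>n. \<forall>B\<in>A (Suc n). \<exists>C\<in>A n. B \<subseteq> C)"

definition cell :: "(nat \<Rightarrow> 'a set set) \<Rightarrow> nat \<Rightarrow> 'a \<Rightarrow> 'a set" where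
  "cell A n x = (THE B. B \<in> A n \<and> x \<in> B)"

definition gamma2 :: "'a set \<Rightarrow> ('a \<Rightarrow> 'a \<Rightarrow> real) \<Rightarrow> ennreal" where
  "gamma2 X d = (INF A \<in> {A. admissible X A}.
       SUP x \<in> X. (\<Sum>n. ennreal (2 powr (real n / 2) * diam_d d (cell A n x))))"

end

theory Submission
  imports Defs "HOL-Probability.Probability"
begin

text \<open>
  Splitting the rows into groups of \<open>T\<close> and applying Parseval to a zero-padded convolution of length \<open>3 T\<close> bounds
  the Toeplitz norm, up to \<open>sqrt 2\<close>, by the maximum over \<open>3 T\<close> frequencies of the Euclidean norm
  of the Fourier transform of the blocks, uniformly in \<open>R\<close>. By the dual Sudakov inequality (disjoint
  translates of a set of Gaussian measure at least \<open>1 / 2\<close>) the entropy numbers of the sphere at level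
  \<open>2 ^ k\<close> are at most a constant times \<open>sqrt (T p log T) / 2 ^ (k / 2)\<close>. Summed over the
  \<open>O(log (T p))\<close> levels below \<open>2 ^ K ~ (T p)^2\<close> this gives the logarithmic bound; beyond that a
  lattice covering makes the series geometric. The bound \<open>T sqrt p\<close> uses only the comparison of the
  Toeplitz norm with \<open>sqrt T\<close> times the Euclidean norm and the lattice covering.
\<close>

section \<open>Spectral bound for the Toeplitz norm\<close>

text \<open>The obstacle is \<open>R\<close>: as \<open>R\<close> grows the Toeplitz norm sees a
  continuum of frequencies, while a union bound wants finitely many. \<open>T\<close> consecutive
  rows meet fewer than \<open>2 * T\<close> block columns, so a transform long enough to avoid
  wrap-around involves a number of frequencies that depends on \<open>T\<close> alone, and each
  column lies in at most two such windows, whence \<open>sqrt 2\<close>. At one frequency the norm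
  is Euclidean in \<open>p\<close> complex coordinates. Treating it as a single seminorm, not
  coordinate by coordinate, keeps the union bound at \<open>3 * T\<close> events:
  \<open>ln (12 * T)\<close> enters the entropy bound and no logarithm of \<open>p\<close>. The
  other logarithm, of \<open>T * p\<close>, counts levels: with decay \<open>2 ^ (- k / 2)\<close>
  every level contributes equally to the chaining sum. The lattice covering has radius of order
  \<open>sqrt T * T * p / 2 ^ k\<close>. Used from \<open>2 ^ K ~ T * p\<close> on, it leaves a tail
  of order \<open>T * sqrt p\<close>, which is already the other bound; from
  \<open>(T * p)^2\<close> on, the tail is only of order \<open>sqrt T\<close>, and the cutoff level
  is still logarithmic.\<close>

lemma sum_cis_orthogonal:
  fixes L a b :: nat
  assumes "a < L" "b < L"
  shows "(\<Sum>m<L. cis (2 * pi * real m * real a / real L) * cnj (cis (2 * pi * real m * real b / real L)))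
       = (if a = b then of_nat L else 0)"
proof -
  define z where "z = cis (2 * pi * (real a - real b) / real L)"
  have L: "real L > 0" using assms by simp
  have term_eq: "cis (2 * pi * real m * real a / real L) * cnj (cis (2 * pi * real m * real b / real L)) = z ^ m" for m
    by (simp add: z_def Complex.DeMoivre cis_cnj cis_mult diff_divide_distrib algebra_simps)
  have zL: "z ^ L = 1"
  proof -
    have "z ^ L = cis (2 * pi * (real a - real b))"
      using L by (simp add: z_def Complex.DeMoivre)
    also have "\<dots> = 1" by (rule cis_multiple_2pi) (auto intro: Ints_diff)
    finally show ?thesis .
  qed
  \<comment> \<open>\<open>z = 1\<close> makes \<open>a - b\<close> an integer multiple of
    \<open>L\<close>, and \<open>\<bar>a - b\<bar> < L\<close> leaves only the multiple
    zero.\<close>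
  have z1: "a = b" if "z = 1"
  proof -
    from that obtain n :: int where "2 * pi * (real a - real b) / real L = of_int n * (2 * pi)"
      unfolding z_def by (auto simp: complex_eq_iff cos_one_2pi_int algebra_simps)
    hence "(2 * pi) * (real a - real b) = (2 * pi) * (of_int n * real L)" using L by (simp add: field_simps)
    hence "real a - real b = of_int n * real L" by simp
    hence *: "int a - int b = n * int L" by (metis of_int_eq_iff of_int_diff of_int_mult of_int_of_nat_eq)
    have "\<bar>int a - int b\<bar> < int L" using assms by linarith
    hence "\<bar>n\<bar> * int L < 1 * int L" using * by (simp add: abs_mult)
    hence "\<bar>n\<bar> < 1" by (simp only: mult_less_cancel_right)
    thus ?thesis using * by simp
  qed
  show ?thesis
  proof (cases "a = b")
    case True
    hence "z = 1" by (simp add: z_def)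
    thus ?thesis unfolding term_eq using True by simp
  next
    case False
    hence "z \<noteq> 1" using z1 by blast
    hence "(\<Sum>m<L. z ^ m) = 0" by (simp add: geometric_sum zL)
    thus ?thesis unfolding term_eq using False by simp
  qed
qed

lemma parseval_dft:
  fixes f :: "nat \<Rightarrow> real"
  shows "(\<Sum>m<L. (cmod (\<Sum>c<L. complex_of_real (f c) * cis (2 * pi * real m * real c / real L)))\<^sup>2)
       = real L * (\<Sum>c<L. (f c)\<^sup>2)"
proof -
  define e where "e m c = cis (2 * pi * real m * real c / real L)" for m c
  have orth: "(\<Sum>m<L. e m a * cnj (e m b)) = (if a = b then of_nat L else 0)" if "a < L" "b < L" for a b
    unfolding e_def by (rule sum_cis_orthogonal[OF that])
  have "complex_of_real (\<Sum>m<L. (cmod (\<Sum>c<L. complex_of_real (f c) * e m c))\<^sup>2)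
      = (\<Sum>m<L. (\<Sum>c<L. complex_of_real (f c) * e m c) * cnj (\<Sum>c<L. complex_of_real (f c) * e m c))"
    unfolding of_real_sum complex_norm_square ..
  also have "\<dots> = (\<Sum>m<L. \<Sum>a<L. \<Sum>b<L. complex_of_real (f a) * complex_of_real (f b) * (e m a * cnj (e m b)))"
    by (simp add: sum_product algebra_simps)
  also have "\<dots> = (\<Sum>a<L. \<Sum>m<L. \<Sum>b<L. complex_of_real (f a) * complex_of_real (f b) * (e m a * cnj (e m b)))"
    by (rule sum.swap)
  also have "\<dots> = (\<Sum>a<L. \<Sum>b<L. \<Sum>m<L. complex_of_real (f a) * complex_of_real (f b) * (e m a * cnj (e m b)))"
    by (intro sum.cong refl sum.swap)
  also have "\<dots> = (\<Sum>a<L. \<Sum>b<L. complex_of_real (f a) * complex_of_real (f b) * (if a = b then of_nat L else 0))"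
    by (intro sum.cong refl) (simp add: sum_distrib_left[symmetric] orth)
  also have "\<dots> = (\<Sum>a<L. complex_of_real (f a) * complex_of_real (f a) * of_nat L)"
    by (intro sum.cong refl) (simp add: if_distrib[of "\<lambda>x. _ * x"] cong: if_cong)
  also have "\<dots> = complex_of_real (real L * (\<Sum>c<L. (f c)\<^sup>2))"
    by (simp add: sum_distrib_left sum_distrib_right power2_eq_square algebra_simps)
  finally show ?thesis unfolding e_def using of_real_eq_iff by blast
qed

text \<open>At each frequency the transform of the convolution is the sum over \<open>j\<close> of
  \<open>W m j * X m j\<close>. Cauchy-Schwarz in \<open>j\<close> splits off the kernel, which
  \<open>B\<close> bounds at every frequency, and Parseval for the zero-padded \<open>x\<close>
  yields a factor \<open>real L\<close> that cancels the one from Parseval for the output.\<close>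

lemma convolution_energy_le:
  fixes w x :: "nat \<Rightarrow> nat \<Rightarrow> real" and T p :: nat and B :: real
  assumes T: "T \<ge> 1"
  assumes B: "\<And>m. m < 3 * T \<Longrightarrow>
    (\<Sum>j<p. (cmod (\<Sum>u<T. complex_of_real (w u j) * cis (2 * pi * real m * real u / real (3 * T))))\<^sup>2) \<le> B"
  shows "(\<Sum>n<3*T. (\<Sum>j<p. \<Sum>u<T. \<Sum>c<2*T. if u + c = n then w u j * x c j else 0)\<^sup>2)
       \<le> B * (\<Sum>c<2*T. \<Sum>j<p. (x c j)\<^sup>2)"
proof -
  define L where "L = 3 * T"
  define e where "e m c = cis (2 * pi * real m * real c / real L)" for m c :: nat
  define W where "W m j = (\<Sum>u<T. complex_of_real (w u j) * e m u)" for m j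
  define X where "X m j = (\<Sum>c<2*T. complex_of_real (x c j) * e m c)" for m j
  define y where "y n = (\<Sum>j<p. \<Sum>u<T. \<Sum>c<2*T. if u + c = n then w u j * x c j else 0)" for n
  have e_add: "e m (u + c) = e m u * e m c" for m u c
    by (simp add: e_def cis_mult algebra_simps add_divide_distrib)
  have hat: "(\<Sum>n<L. complex_of_real (y n) * e m n) = (\<Sum>j<p. W m j * X m j)" for m
  proof -
    have "(\<Sum>n<L. complex_of_real (y n) * e m n)
        = (\<Sum>n<L. \<Sum>j<p. \<Sum>u<T. \<Sum>c<2*T. if u + c = n then complex_of_real (w u j * x c j) * e m n else 0)"
      unfolding y_def of_real_sum sum_distrib_right by (intro sum.cong refl) simp
    also have "\<dots> = (\<Sum>j<p. \<Sum>n<L. \<Sum>u<T. \<Sum>c<2*T. if u + c = n then complex_of_real (w u j * x c j) * e m n else 0)"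
      by (rule sum.swap)
    also have "\<dots> = (\<Sum>j<p. \<Sum>u<T. \<Sum>n<L. \<Sum>c<2*T. if u + c = n then complex_of_real (w u j * x c j) * e m n else 0)"
      by (intro sum.cong refl sum.swap)
    also have "\<dots> = (\<Sum>j<p. \<Sum>u<T. \<Sum>c<2*T. \<Sum>n<L. if u + c = n then complex_of_real (w u j * x c j) * e m n else 0)"
      by (intro sum.cong refl sum.swap)
    \<comment> \<open>Here \<open>u + c \<le> 3 * T - 2 < L\<close>, so each pair
      \<open>(u, c)\<close> meets exactly one \<open>n\<close>; the length \<open>3 * T\<close> is
      what excludes wrap-around.\<close>
    also have "\<dots> = (\<Sum>j<p. \<Sum>u<T. \<Sum>c<2*T. complex_of_real (w u j) * e m u * (complex_of_real (x c j) * e m c))"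
      by (intro sum.cong refl) (auto simp: L_def e_add)
    also have "\<dots> = (\<Sum>j<p. W m j * X m j)"
      by (simp add: W_def X_def sum_product)
    finally show ?thesis .
  qed
  have cs: "(cmod (\<Sum>j<p. W m j * X m j))\<^sup>2 \<le> (\<Sum>j<p. (cmod (W m j))\<^sup>2) * (\<Sum>j<p. (cmod (X m j))\<^sup>2)" for m
  proof -
    have "cmod (\<Sum>j<p. W m j * X m j) \<le> (\<Sum>j<p. cmod (W m j) * cmod (X m j))"
      by (rule order_trans[OF norm_sum]) (simp add: norm_mult)
    hence "(cmod (\<Sum>j<p. W m j * X m j))\<^sup>2 \<le> (\<Sum>j<p. cmod (W m j) * cmod (X m j))\<^sup>2"
      by (rule power_mono) simp
    also have "\<dots> \<le> (\<Sum>j<p. (cmod (W m j))\<^sup>2) * (\<Sum>j<p. (cmod (X m j))\<^sup>2)"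
      by (rule Cauchy_Schwarz_ineq_sum)
    finally show ?thesis .
  qed
  have parsX: "(\<Sum>m<L. (cmod (X m j))\<^sup>2) = real L * (\<Sum>c<2*T. (x c j)\<^sup>2)" for j
  proof -
    have sub: "{..<L} \<inter> {c. c < 2 * T} = {..<2*T}" by (auto simp: L_def)
    have "X m j = (\<Sum>c<L. complex_of_real (if c < 2*T then x c j else 0) * e m c)" for m
    proof -
      have "(\<Sum>c<L. complex_of_real (if c < 2*T then x c j else 0) * e m c)
          = (\<Sum>c<L. if c \<in> {c. c < 2*T} then complex_of_real (x c j) * e m c else 0)"
        by (intro sum.cong) auto
      thus ?thesis by (simp only: sum.inter_restrict[symmetric, OF finite_lessThan] sub X_def)
    qed
    hence "(\<Sum>m<L. (cmod (X m j))\<^sup>2) = real L * (\<Sum>c<L. (if c < 2*T then x c j else 0)\<^sup>2)"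
      unfolding e_def by (simp only: parseval_dft)
    also have "(\<Sum>c<L. (if c < 2*T then x c j else 0)\<^sup>2) = (\<Sum>c<L. if c \<in> {c. c < 2*T} then (x c j)\<^sup>2 else 0)"
      by (intro sum.cong) auto
    also have "\<dots> = (\<Sum>c<2*T. (x c j)\<^sup>2)"
      by (simp only: sum.inter_restrict[symmetric, OF finite_lessThan] sub)
    finally show ?thesis .
  qed
  have "real L * (\<Sum>n<L. (y n)\<^sup>2) = (\<Sum>m<L. (cmod (\<Sum>j<p. W m j * X m j))\<^sup>2)"
    using parseval_dft[of y L] unfolding e_def[symmetric] hat by simp
  also have "\<dots> \<le> (\<Sum>m<L. B * (\<Sum>j<p. (cmod (X m j))\<^sup>2))"
  proof (rule sum_mono)
    fix m assume "m \<in> {..<L}"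
    hence "(\<Sum>j<p. (cmod (W m j))\<^sup>2) \<le> B"
      using B[of m] by (simp add: W_def e_def L_def)
    thus "(cmod (\<Sum>j<p. W m j * X m j))\<^sup>2 \<le> B * (\<Sum>j<p. (cmod (X m j))\<^sup>2)"
      by (intro order_trans[OF cs] mult_right_mono sum_nonneg) auto
  qed
  also have "\<dots> = B * (\<Sum>j<p. \<Sum>m<L. (cmod (X m j))\<^sup>2)"
    by (simp add: sum_distrib_left[symmetric] sum.swap[of _ "{..<p}"])
  also have "\<dots> = real L * (B * (\<Sum>j<p. \<Sum>c<2*T. (x c j)\<^sup>2))"
    by (simp add: parsX sum_distrib_left[symmetric])
  also have "(\<Sum>j<p. \<Sum>c<2*T. (x c j)\<^sup>2) = (\<Sum>c<2*T. \<Sum>j<p. (x c j)\<^sup>2)"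
    by (rule sum.swap)
  finally show ?thesis
    using T by (simp add: L_def y_def)
qed

text \<open>Cut each window into its two halves of length \<open>T\<close>. The left halves are
  pairwise disjoint, so are the right halves, and each family costs the full sum at most
  once.\<close>

lemma sum_overlapping_windows_le:
  fixes F :: "nat \<Rightarrow> real"
  assumes "\<And>c. F c \<ge> 0"
  shows "(\<Sum>b<G. \<Sum>c<2*T. F (b * T + c)) \<le> 2 * (\<Sum>c<(G + 1) * T. F c)"
proof -
  have split: "(\<Sum>c<2*T. F (b * T + c)) = (\<Sum>c<T. F (b * T + c)) + (\<Sum>c<T. F (Suc b * T + c))" for b
  proof -
    have "(\<Sum>c<2*T. F (b * T + c)) = (\<Sum>i<2. \<Sum>c<T. F (b * T + (c + i * T)))"
      by (rule sum_mult_product)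
    thus ?thesis by (simp add: numeral_2_eq_2 algebra_simps)
  qed
  have group: "(\<Sum>b<G. \<Sum>c<T. H (b * T + c)) = (\<Sum>c<G * T. H c)" for H :: "nat \<Rightarrow> real"
    by (simp add: sum_mult_product add.commute)
  have "(\<Sum>b<G. \<Sum>c<T. F (Suc b * T + c)) = (\<Sum>c<G * T. F (T + c))"
    using group[of "\<lambda>c. F (T + c)"] by (simp add: algebra_simps)
  also have "\<dots> = (\<Sum>c\<in>(+) T ` {..<G*T}. F c)" by (subst sum.reindex) auto
  also have "\<dots> \<le> (\<Sum>c<(G + 1) * T. F c)"
    by (rule sum_mono2) (auto simp: assms)
  finally have 1: "(\<Sum>b<G. \<Sum>c<T. F (Suc b * T + c)) \<le> (\<Sum>c<(G + 1) * T. F c)" .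
  have 2: "(\<Sum>b<G. \<Sum>c<T. F (b * T + c)) \<le> (\<Sum>c<(G + 1) * T. F c)"
    unfolding group by (rule sum_mono2) (auto simp: assms)
  show ?thesis unfolding split sum.distrib using 1 2 by linarith
qed

text \<open>The substitution \<open>u = T - 1 - (c - r)\<close> turns row \<open>r\<close> into a
  sum over \<open>u + c = r + T - 1\<close>, a convolution. Measured from the offset
  \<open>b * T\<close>, the row \<open>s\<close> of group \<open>b\<close> is the entry
  \<open>s + T - 1\<close> of the convolution of the kernel with one window of \<open>2 * T\<close>
  blocks. \<open>y\<close> continues \<open>x\<close> by zero because a window may reach past the
  last block column.\<close>

lemma toep_row_eq_convolution:
  fixes v x :: "nat \<Rightarrow> real"
  assumes T: "T \<ge> 1" and p: "p \<ge> 1" and s: "s < T" and r: "b * T + s < R"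
  defines "y \<equiv> \<lambda>c j. if c < R + T - 1 then x (c * p + j) else 0"
  shows "(\<Sum>k<(R + T - 1) * p. toep_entry T p v (b * T + s) k * x k)
       = (\<Sum>j<p. \<Sum>u<T. \<Sum>c<2*T. if u + c = s + T - 1 then v (u * p + j) * y (b * T + c) j else 0)"
proof -
  define r where "r = b * T + s"
  have entry: "toep_entry T p v r (j + c * p) = (if r \<le> c \<and> c < r + T then v ((T - 1 - (c - r)) * p + j) else 0)"
    if "j < p" for c j
    using that p by (simp add: toep_entry_def)
  have "(\<Sum>k<(R + T - 1) * p. toep_entry T p v r k * x k)
      = (\<Sum>c<R + T - 1. \<Sum>j<p. toep_entry T p v r (j + c * p) * x (j + c * p))"
    by (rule sum_mult_product)
  also have "\<dots> = (\<Sum>j<p. \<Sum>c<R + T - 1. toep_entry T p v r (j + c * p) * x (j + c * p))"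
    by (rule sum.swap)
  also have "\<dots> = (\<Sum>j<p. \<Sum>u<T. v (u * p + j) * y (r + T - 1 - u) j)"
  proof (rule sum.cong[OF refl])
    fix j assume "j \<in> {..<p}"
    hence j: "j < p" by simp
    have "(\<Sum>c<R + T - 1. toep_entry T p v r (j + c * p) * x (j + c * p))
        = (\<Sum>c\<in>{r..<r+T}. toep_entry T p v r (j + c * p) * x (j + c * p))"
      using assms(4)[folded r_def] by (intro sum.mono_neutral_right) (auto simp: entry j)
    also have "\<dots> = (\<Sum>u<T. v (u * p + j) * y (r + T - 1 - u) j)"
      using assms(4)[folded r_def] T
      by (intro sum.reindex_bij_witness[of _ "\<lambda>u. r + T - 1 - u" "\<lambda>c. r + T - 1 - c"])
         (auto simp: entry j y_def add.commute)
    finally show "(\<Sum>c<R + T - 1. toep_entry T p v r (j + c * p) * x (j + c * p))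
        = (\<Sum>u<T. v (u * p + j) * y (r + T - 1 - u) j)" .
  qed
  also have "\<dots> = (\<Sum>j<p. \<Sum>u<T. \<Sum>c<2*T. if u + c = s + T - 1 then v (u * p + j) * y (b * T + c) j else 0)"
  proof (intro sum.cong refl)
    fix j u assume "u \<in> {..<T}"
    hence u: "u < T" by simp
    have "(\<Sum>c<2*T. if u + c = s + T - 1 then v (u * p + j) * y (b * T + c) j else 0)
        = (\<Sum>c<2*T. if c = s + T - 1 - u then v (u * p + j) * y (b * T + c) j else 0)"
      using u by (intro sum.cong refl) auto
    also have "\<dots> = v (u * p + j) * y (r + T - 1 - u) j"
    proof -
      have "s + T - 1 - u < 2 * T" "b * T + (s + T - 1 - u) = r + T - 1 - u"
        using u s by (auto simp: r_def)
      thus ?thesis by simp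
    qed
    finally show "v (u * p + j) * y (r + T - 1 - u) j
      = (\<Sum>c<2*T. if u + c = s + T - 1 then v (u * p + j) * y (b * T + c) j else 0)" by simp
  qed
  finally show ?thesis by (simp add: r_def)
qed

text \<open>The rows of one group are \<open>T\<close> of the \<open>3 * T\<close> entries of a
  single convolution, so the energy bound applies group by group. Adding the groups counts each
  input block at most twice.\<close>

lemma toep_norm_le_spectral:
  fixes v :: "nat \<Rightarrow> real"
  assumes T: "T \<ge> 1" and p: "p \<ge> 1" and rho: "\<rho> \<ge> 0"
  assumes B: "\<And>m. m < 3 * T \<Longrightarrow>
    (\<Sum>j<p. (cmod (\<Sum>u<T. complex_of_real (v (u * p + j)) * cis (2 * pi * real m * real u / real (3 * T))))\<^sup>2) \<le> \<rho>\<^sup>2"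
  shows "toep_norm T p R v \<le> sqrt 2 * \<rho>"
  unfolding toep_norm_def op_norm_def
proof (rule cSup_least)
  show "{sqrt (\<Sum>r<R. (\<Sum>k<(R + T - 1) * p. toep_entry T p v r k * x k)\<^sup>2) |x.
      (\<Sum>k<(R + T - 1) * p. (x k)\<^sup>2) \<le> 1} \<noteq> {}"
    by (auto intro!: exI[of _ "\<lambda>_. 0"])
  fix t assume "t \<in> {sqrt (\<Sum>r<R. (\<Sum>k<(R + T - 1) * p. toep_entry T p v r k * x k)\<^sup>2) |x.
      (\<Sum>k<(R + T - 1) * p. (x k)\<^sup>2) \<le> 1}"
  then obtain x where t: "t = sqrt (\<Sum>r<R. (\<Sum>k<(R + T - 1) * p. toep_entry T p v r k * x k)\<^sup>2)"
    and x: "(\<Sum>k<(R + T - 1) * p. (x k)\<^sup>2) \<le> 1" by blast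
  define y where "y c j = (if c < R + T - 1 then x (c * p + j) else 0)" for c j
  \<comment> \<open>Rows from \<open>R\<close> on count as zero, which completes the rows to
    \<open>R\<close> full groups of length \<open>T\<close>; these contain all rows since
    \<open>T \<ge> 1\<close>.\<close>
  define z where "z r = (if r < R then (\<Sum>k<(R + T - 1) * p. toep_entry T p v r k * x k)\<^sup>2 else 0)" for r
  define conv where "conv b n = (\<Sum>j<p. \<Sum>u<T. \<Sum>c<2*T. if u + c = n then v (u * p + j) * y (b * T + c) j else 0)" for b n
  have z_le: "z (b * T + s) \<le> (conv b (s + T - 1))\<^sup>2" if "s < T" for b s
    using toep_row_eq_convolution[OF T p that, of b R v x] unfolding z_def conv_def y_def by simp
  have y_energy: "(\<Sum>c<G. \<Sum>j<p. (y c j)\<^sup>2) \<le> 1" for G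
  proof -
    have "(\<Sum>c<G. \<Sum>j<p. (y c j)\<^sup>2) \<le> (\<Sum>c<max G (R+T-1). \<Sum>j<p. (y c j)\<^sup>2)"
      by (rule sum_mono2) (auto intro: sum_nonneg)
    also have "\<dots> = (\<Sum>c<R+T-1. \<Sum>j<p. (y c j)\<^sup>2)"
      by (rule sum.mono_neutral_right) (auto simp: y_def)
    also have "\<dots> = (\<Sum>c<R+T-1. \<Sum>j<p. (x (j + c * p))\<^sup>2)"
      by (intro sum.cong refl) (auto simp: y_def add.commute)
    also have "\<dots> = (\<Sum>k<(R + T - 1) * p. (x k)\<^sup>2)"
      by (rule sum_mult_product[symmetric])
    finally show ?thesis using x by simp
  qed
  have "(\<Sum>r<R. (\<Sum>k<(R + T - 1) * p. toep_entry T p v r k * x k)\<^sup>2) = (\<Sum>r<R. z r)"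
    by (simp add: z_def)
  also have "\<dots> \<le> (\<Sum>r<R * T. z r)"
    using T by (intro sum_mono2) (auto simp: z_def intro: order_less_le_trans)
  also have "\<dots> = (\<Sum>b<R. \<Sum>s<T. z (s + b * T))"
    by (rule sum_mult_product)
  also have "\<dots> \<le> (\<Sum>b<R. \<Sum>s<T. (conv b (s + T - 1))\<^sup>2)"
    using z_le by (intro sum_mono) (simp add: add.commute)
  also have "\<dots> \<le> (\<Sum>b<R. \<Sum>n<3*T. (conv b n)\<^sup>2)"
  proof (rule sum_mono)
    fix b
    have "(\<Sum>s<T. (conv b (s + T - 1))\<^sup>2) = (\<Sum>n\<in>(\<lambda>s. s + T - 1) ` {..<T}. (conv b n)\<^sup>2)"
      by (subst sum.reindex) (auto simp: inj_on_def)
    also have "\<dots> \<le> (\<Sum>n<3*T. (conv b n)\<^sup>2)"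
      by (rule sum_mono2) auto
    finally show "(\<Sum>s<T. (conv b (s + T - 1))\<^sup>2) \<le> (\<Sum>n<3*T. (conv b n)\<^sup>2)" .
  qed
  also have "\<dots> \<le> (\<Sum>b<R. \<rho>\<^sup>2 * (\<Sum>c<2*T. \<Sum>j<p. (y (b * T + c) j)\<^sup>2))"
    unfolding conv_def by (intro sum_mono convolution_energy_le T B)
  also have "\<dots> = \<rho>\<^sup>2 * (\<Sum>b<R. \<Sum>c<2*T. \<Sum>j<p. (y (b * T + c) j)\<^sup>2)"
    by (simp add: sum_distrib_left)
  also have "\<dots> \<le> \<rho>\<^sup>2 * (2 * (\<Sum>c<(R + 1) * T. \<Sum>j<p. (y c j)\<^sup>2))"
    by (intro mult_left_mono sum_overlapping_windows_le sum_nonneg) auto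
  also have "\<dots> \<le> \<rho>\<^sup>2 * (2 * 1)"
    by (intro mult_left_mono y_energy) auto
  finally have "t \<le> sqrt (\<rho>\<^sup>2 * (2 * 1))" unfolding t by (rule real_sqrt_le_mono)
  thus "t \<le> sqrt 2 * \<rho>" using rho by (simp add: real_sqrt_mult mult.commute)
qed

text \<open>Cauchy-Schwarz against \<open>T\<close> phases of modulus one. The factor
  \<open>real T\<close> is attained at \<open>\<theta> = 0\<close> by blocks that do not depend on
  \<open>u\<close>.\<close>

lemma spectral_energy_le:
  fixes v :: "nat \<Rightarrow> real" and \<theta> :: real
  shows "(\<Sum>j<p. (cmod (\<Sum>u<T. complex_of_real (v (u * p + j)) * cis (\<theta> * real u)))\<^sup>2)
       \<le> real T * (\<Sum>k<T * p. (v k)\<^sup>2)"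
proof -
  have "(\<Sum>j<p. (cmod (\<Sum>u<T. complex_of_real (v (u * p + j)) * cis (\<theta> * real u)))\<^sup>2)
      \<le> (\<Sum>j<p. real T * (\<Sum>u<T. (v (u * p + j))\<^sup>2))"
  proof (rule sum_mono)
    fix j
    have "cmod (\<Sum>u<T. complex_of_real (v (u * p + j)) * cis (\<theta> * real u)) \<le> (\<Sum>u<T. 1 * \<bar>v (u * p + j)\<bar>)"
      by (rule order_trans[OF norm_sum]) (simp add: norm_mult)
    hence "(cmod (\<Sum>u<T. complex_of_real (v (u * p + j)) * cis (\<theta> * real u)))\<^sup>2 \<le> (\<Sum>u<T. 1 * \<bar>v (u * p + j)\<bar>)\<^sup>2"
      by (rule power_mono) simp
    also have "\<dots> \<le> (\<Sum>u<T. 1\<^sup>2) * (\<Sum>u<T. \<bar>v (u * p + j)\<bar>\<^sup>2)"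
      by (rule Cauchy_Schwarz_ineq_sum)
    finally show "(cmod (\<Sum>u<T. complex_of_real (v (u * p + j)) * cis (\<theta> * real u)))\<^sup>2
        \<le> real T * (\<Sum>u<T. (v (u * p + j))\<^sup>2)" by simp
  qed
  also have "\<dots> = real T * (\<Sum>u<T. \<Sum>j<p. (v (j + u * p))\<^sup>2)"
    by (simp add: sum_distrib_left[symmetric] sum.swap[of _ "{..<p}"] add.commute)
  also have "\<dots> = real T * (\<Sum>k<T * p. (v k)\<^sup>2)"
    by (simp only: sum_mult_product)
  finally show ?thesis .
qed

section \<open>Gaussian measure and dual Sudakov minoration\<close>

text \<open>Points are extensional functions, \<open>undefined\<close> outside
  \<open>{..<N}\<close>; this is why every shift below is restricted by
  \<open>\<lambda>i\<in>{..<N}\<close>.\<close>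

definition gauss :: "nat \<Rightarrow> (nat \<Rightarrow> real) measure" where
  "gauss N = PiM {..<N} (\<lambda>_. density lborel std_normal_density)"

lemma prob_space_gauss: "prob_space (gauss N)"
  unfolding gauss_def by (intro prob_space_PiM prob_space_normal_density) simp

lemma sets_gauss [measurable_cong]: "sets (gauss N) = sets (PiM {..<N} (\<lambda>_. borel))"
  unfolding gauss_def by (intro sets_PiM_cong) auto

lemma space_gauss: "space (gauss N) = {..<N} \<rightarrow>\<^sub>E UNIV"
  by (simp add: gauss_def space_PiM)

text \<open>One-dimensional Cameron-Martin formula: the quotient of the normal densities at
  \<open>x - a\<close> and at \<open>x\<close> is \<open>exp (a * x - a^2 / 2)\<close>.\<close>

lemma std_normal_shift:
  fixes a :: real
  shows "distr (density lborel std_normal_density) borel (\<lambda>x. x + a)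
       = density (density lborel std_normal_density) (\<lambda>x. ennreal (exp (a * x - a\<^sup>2 / 2)))"
proof (rule measure_eqI)
  fix A assume "A \<in> sets (distr (density lborel std_normal_density) borel (\<lambda>x. x + a))"
  hence A[measurable]: "A \<in> sets borel" by simp
  have "emeasure (distr (density lborel std_normal_density) borel (\<lambda>x. x + a)) A
      = (\<integral>\<^sup>+x. indicator A x \<partial>distr (density lborel std_normal_density) borel (\<lambda>x. x + a))"
    by simp
  also have "\<dots> = (\<integral>\<^sup>+x. indicator A (x + a) \<partial>density lborel std_normal_density)"
    by (subst nn_integral_distr) auto
  also have "\<dots> = (\<integral>\<^sup>+x. ennreal (std_normal_density x) * indicator A (x + a) \<partial>lborel)"
    by (subst nn_integral_density) auto
  also have "\<dots> = (\<integral>\<^sup>+x. ennreal (std_normal_density (x - a)) * indicator A x \<partial>lborel)"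
    by (subst nn_integral_real_affine[where c=1 and t="-a"]) auto
  also have "\<dots> = (\<integral>\<^sup>+x. ennreal (std_normal_density x) * (ennreal (exp (a * x - a\<^sup>2 / 2)) * indicator A x) \<partial>lborel)"
  proof (rule nn_integral_cong)
    fix x :: real
    have "std_normal_density (x - a) = std_normal_density x * exp (a * x - a\<^sup>2 / 2)"
      by (simp add: std_normal_density_def exp_add[symmetric] power2_eq_square field_simps)
    thus "ennreal (std_normal_density (x - a)) * indicator A x
        = ennreal (std_normal_density x) * (ennreal (exp (a * x - a\<^sup>2 / 2)) * indicator A x)"
      by (simp add: ennreal_mult mult.assoc)
  qed
  also have "\<dots> = (\<integral>\<^sup>+x. ennreal (exp (a * x - a\<^sup>2 / 2)) * indicator A x \<partial>density lborel std_normal_density)"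
    by (subst nn_integral_density) auto
  also have "\<dots> = emeasure (density (density lborel std_normal_density) (\<lambda>x. ennreal (exp (a * x - a\<^sup>2 / 2)))) A"
    by (subst emeasure_density) auto
  finally show "emeasure (distr (density lborel std_normal_density) borel (\<lambda>x. x + a)) A
    = emeasure (density (density lborel std_normal_density) (\<lambda>x. ennreal (exp (a * x - a\<^sup>2 / 2)))) A" .
qed simp

text \<open>Cameron-Martin formula in \<open>N\<close> dimensions. Both sides equal the product of
  the shifted one-dimensional laws: it is enough to compare on boxes, where the exponential density
  factorises.\<close>

lemma gauss_shift:
  fixes a :: "nat \<Rightarrow> real"
  shows "distr (gauss N) (gauss N) (\<lambda>x. \<lambda>i\<in>{..<N}. x i + a i)
       = density (gauss N) (\<lambda>x. ennreal (exp ((\<Sum>i<N. a i * x i) - (\<Sum>i<N. (a i)\<^sup>2) / 2)))"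
proof -
  define \<gamma> where "\<gamma> = density lborel std_normal_density"
  define M where "M i = density \<gamma> (\<lambda>x. ennreal (exp (a i * x - (a i)\<^sup>2 / 2)))" for i
  have sets_\<gamma>[measurable_cong, simp]: "sets \<gamma> = sets borel" by (simp add: \<gamma>_def)
  have space_\<gamma>[simp]: "space \<gamma> = UNIV" by (simp add: \<gamma>_def)
  have M_distr: "M i = distr \<gamma> borel (\<lambda>x. x + a i)" for i
    by (simp add: M_def \<gamma>_def std_normal_shift)
  have \<gamma>: "prob_space \<gamma>" unfolding \<gamma>_def by (rule prob_space_normal_density) simp
  have M: "prob_space (M i)" for i
    unfolding M_distr by (rule prob_space.prob_space_distr[OF \<gamma>]) simp
  interpret G: product_prob_space "\<lambda>_. \<gamma>" "{..<N}" by (rule product_prob_spaceI) (rule \<gamma>)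
  interpret MM: product_prob_space M "{..<N}" by (rule product_prob_spaceI) (rule M)
  have sets_M[simp]: "sets (M i) = sets borel" for i by (simp add: M_def)
  have gauss_eq: "gauss N = PiM {..<N} (\<lambda>_. \<gamma>)" by (simp add: gauss_def \<gamma>_def)
  have sets_eq: "sets (PiM {..<N} M) = sets (gauss N)"
    unfolding sets_gauss by (rule sets_PiM_cong) auto
  have meas: "(\<lambda>x. \<lambda>i\<in>{..<N}. x i + a i) \<in> gauss N \<rightarrow>\<^sub>M gauss N"
    by measurable
  have 1: "distr (gauss N) (gauss N) (\<lambda>x. \<lambda>i\<in>{..<N}. x i + a i) = PiM {..<N} M"
  proof (rule MM.PiM_eqI)
    fix A assume "\<And>i. i \<in> {..<N} \<Longrightarrow> A i \<in> sets (M i)"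
    hence A[measurable]: "\<And>i. i \<in> {..<N} \<Longrightarrow> A i \<in> sets borel" by simp
    have "Pi\<^sub>E {..<N} A \<in> sets (gauss N)"
      unfolding sets_gauss by (rule sets_PiM_I_finite) (use A in auto)
    hence "emeasure (distr (gauss N) (gauss N) (\<lambda>x. \<lambda>i\<in>{..<N}. x i + a i)) (Pi\<^sub>E {..<N} A)
        = emeasure (gauss N) ((\<lambda>x. \<lambda>i\<in>{..<N}. x i + a i) -` (Pi\<^sub>E {..<N} A) \<inter> space (gauss N))"
      by (rule emeasure_distr[OF meas])
    also have "(\<lambda>x. \<lambda>i\<in>{..<N}. x i + a i) -` (Pi\<^sub>E {..<N} A) \<inter> space (gauss N)
        = Pi\<^sub>E {..<N} (\<lambda>i. (\<lambda>x. x + a i) -` A i)"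
      by (auto simp: space_gauss PiE_iff)
    also have "emeasure (gauss N) \<dots> = (\<Prod>i<N. emeasure \<gamma> ((\<lambda>x. x + a i) -` A i))"
    proof -
      have "(\<lambda>x. x + a i) -` A i \<in> sets \<gamma>" if "i \<in> {..<N}" for i
        using measurable_sets[of "\<lambda>x. x + a i" borel borel "A i"] A[OF that] by simp
      thus ?thesis unfolding gauss_eq by (subst G.emeasure_PiM) auto
    qed
    also have "\<dots> = (\<Prod>i<N. emeasure (M i) (A i))"
      by (intro prod.cong refl) (simp add: M_distr emeasure_distr A)
    finally show "emeasure (distr (gauss N) (gauss N) (\<lambda>x. \<lambda>i\<in>{..<N}. x i + a i)) (Pi\<^sub>E {..<N} A)
        = (\<Prod>i<N. emeasure (M i) (A i))" .
  qed (auto simp: sets_eq)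
  have 2: "density (gauss N) (\<lambda>x. ennreal (exp ((\<Sum>i<N. a i * x i) - (\<Sum>i<N. (a i)\<^sup>2) / 2))) = PiM {..<N} M"
  proof (rule MM.PiM_eqI)
    fix A assume "\<And>i. i \<in> {..<N} \<Longrightarrow> A i \<in> sets (M i)"
    hence A[measurable]: "\<And>i. i \<in> {..<N} \<Longrightarrow> A i \<in> sets borel" by simp
    have "Pi\<^sub>E {..<N} A \<in> sets (gauss N)"
      unfolding sets_gauss by (rule sets_PiM_I_finite) (use A in auto)
    hence "emeasure (density (gauss N) (\<lambda>x. ennreal (exp ((\<Sum>i<N. a i * x i) - (\<Sum>i<N. (a i)\<^sup>2) / 2)))) (Pi\<^sub>E {..<N} A)
        = (\<integral>\<^sup>+x. ennreal (exp ((\<Sum>i<N. a i * x i) - (\<Sum>i<N. (a i)\<^sup>2) / 2)) * indicator (Pi\<^sub>E {..<N} A) x \<partial>gauss N)"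
      by (subst emeasure_density) auto
    also have "\<dots> = (\<integral>\<^sup>+x. (\<Prod>i<N. ennreal (exp (a i * x i - (a i)\<^sup>2 / 2)) * indicator (A i) (x i)) \<partial>gauss N)"
    proof (rule nn_integral_cong)
      fix x assume "x \<in> space (gauss N)"
      hence "indicator (Pi\<^sub>E {..<N} A) x = (\<Prod>i<N. indicator (A i) (x i) :: ennreal)"
        by (auto simp: space_gauss indicator_def PiE_iff)
      moreover have "ennreal (exp ((\<Sum>i<N. a i * x i) - (\<Sum>i<N. (a i)\<^sup>2) / 2)) = (\<Prod>i<N. ennreal (exp (a i * x i - (a i)\<^sup>2 / 2)))"
        by (simp add: prod_ennreal exp_sum[symmetric] sum_subtractf sum_divide_distrib)
      ultimately show "ennreal (exp ((\<Sum>i<N. a i * x i) - (\<Sum>i<N. (a i)\<^sup>2) / 2)) * indicator (Pi\<^sub>E {..<N} A) x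
        = (\<Prod>i<N. ennreal (exp (a i * x i - (a i)\<^sup>2 / 2)) * indicator (A i) (x i))"
        by (simp add: prod.distrib)
    qed
    also have "\<dots> = (\<Prod>i<N. \<integral>\<^sup>+x. ennreal (exp (a i * x - (a i)\<^sup>2 / 2)) * indicator (A i) x \<partial>\<gamma>)"
      unfolding gauss_eq by (rule G.product_nn_integral_prod) (use A in auto)
    also have "\<dots> = (\<Prod>i<N. emeasure (M i) (A i))"
      by (intro prod.cong refl) (simp add: M_def emeasure_density A)
    finally show "emeasure (density (gauss N) (\<lambda>x. ennreal (exp ((\<Sum>i<N. a i * x i) - (\<Sum>i<N. (a i)\<^sup>2) / 2)))) (Pi\<^sub>E {..<N} A)
        = (\<Prod>i<N. emeasure (M i) (A i))" .
  qed (auto simp: sets_eq)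
  show ?thesis using 1 2 by simp
qed

text \<open>The shifted measure has total mass one. Integrating its density therefore gives the
  Laplace transform with no Gaussian integral to evaluate.\<close>

lemma gauss_exp_linear:
  "(\<integral>\<^sup>+x. ennreal (exp (\<Sum>i<N. a i * x i)) \<partial>gauss N) = ennreal (exp ((\<Sum>i<N. (a i)\<^sup>2) / 2))"
proof -
  let ?s = "(\<Sum>i<N. (a i)\<^sup>2) / 2"
  interpret prob_space "gauss N" by (rule prob_space_gauss)
  have meas: "(\<lambda>x. \<lambda>i\<in>{..<N}. x i + a i) \<in> gauss N \<rightarrow>\<^sub>M gauss N" by measurable
  have "1 = emeasure (distr (gauss N) (gauss N) (\<lambda>x. \<lambda>i\<in>{..<N}. x i + a i)) (space (gauss N))"
    using prob_space.emeasure_space_1[OF prob_space_distr[OF meas]] by simp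
  also have "\<dots> = (\<integral>\<^sup>+x. ennreal (exp ((\<Sum>i<N. a i * x i) - ?s)) \<partial>gauss N)"
    unfolding gauss_shift by (subst emeasure_density) (auto intro!: nn_integral_cong)
  also have "\<dots> = (\<integral>\<^sup>+x. ennreal (exp (- ?s)) * ennreal (exp (\<Sum>i<N. a i * x i)) \<partial>gauss N)"
    by (intro nn_integral_cong) (simp add: ennreal_mult'[symmetric] exp_add[symmetric])
  also have "\<dots> = ennreal (exp (- ?s)) * (\<integral>\<^sup>+x. ennreal (exp (\<Sum>i<N. a i * x i)) \<partial>gauss N)"
    by (rule nn_integral_cmult) measurable
  finally have "ennreal (exp ?s) * (ennreal (exp (- ?s)) * (\<integral>\<^sup>+x. ennreal (exp (\<Sum>i<N. a i * x i)) \<partial>gauss N)) = ennreal (exp ?s)"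
    by simp
  thus ?thesis
    by (simp add: mult.assoc[symmetric] ennreal_mult'[symmetric] exp_add[symmetric])
qed

lemma gauss_cosh_linear:
  "(\<integral>\<^sup>+x. ennreal (cosh (\<Sum>i<N. a i * x i)) \<partial>gauss N) = ennreal (exp ((\<Sum>i<N. (a i)\<^sup>2) / 2))"
proof -
  define c where "c = (1 / 2 :: real)"
  have c: "c \<ge> 0" "2 * c = 1" by (auto simp: c_def)
  have "(\<integral>\<^sup>+x. ennreal (cosh (\<Sum>i<N. a i * x i)) \<partial>gauss N)
      = (\<integral>\<^sup>+x. ennreal c * (ennreal (exp (\<Sum>i<N. a i * x i)) + ennreal (exp (\<Sum>i<N. (- a i) * x i))) \<partial>gauss N)"
  proof (rule nn_integral_cong)
    fix x
    have "cosh (\<Sum>i<N. a i * x i) = c * (exp (\<Sum>i<N. a i * x i) + exp (\<Sum>i<N. (- a i) * x i))"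
      by (simp add: cosh_def c_def sum_negf)
    thus "ennreal (cosh (\<Sum>i<N. a i * x i))
        = ennreal c * (ennreal (exp (\<Sum>i<N. a i * x i)) + ennreal (exp (\<Sum>i<N. (- a i) * x i)))"
      using c(1) by (simp only: ennreal_mult' ennreal_plus exp_ge_zero)
  qed
  also have "\<dots> = ennreal c * (ennreal (exp ((\<Sum>i<N. (a i)\<^sup>2) / 2)) + ennreal (exp ((\<Sum>i<N. (- a i)\<^sup>2) / 2)))"
  proof -
    have "(\<integral>\<^sup>+x. ennreal (exp (\<Sum>i<N. a i * x i)) + ennreal (exp (\<Sum>i<N. (- a i) * x i)) \<partial>gauss N)
        = ennreal (exp ((\<Sum>i<N. (a i)\<^sup>2) / 2)) + ennreal (exp ((\<Sum>i<N. (- a i)\<^sup>2) / 2))"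
      using nn_integral_add[of "\<lambda>x. ennreal (exp (\<Sum>i<N. a i * x i))" "gauss N" "\<lambda>x. ennreal (exp (\<Sum>i<N. (- a i) * x i))"]
      unfolding gauss_exp_linear gauss_exp_linear[of N "\<lambda>i. - a i"] by measurable
    thus ?thesis by (subst nn_integral_cmult) (simp_all only:, measurable)
  qed
  also have "\<dots> = ennreal ((2 * c) * exp ((\<Sum>i<N. (a i)\<^sup>2) / 2))"
    using c(1) by (simp add: ennreal_mult'[symmetric] flip: ennreal_plus)
  finally show ?thesis by (simp add: c)
qed

section \<open>Tails of quadratic Gaussian seminorms\<close>

lemma power_mean_le:
  fixes x :: "'i \<Rightarrow> real"
  assumes "finite I" "I \<noteq> {}" "\<And>i. i \<in> I \<Longrightarrow> x i \<ge> 0"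
  shows "((\<Sum>i\<in>I. x i) / real (card I)) ^ k \<le> (\<Sum>i\<in>I. x i ^ k) / real (card I)"
proof -
  have conv: "convex_on {0..} (\<lambda>t::real. t ^ k)"
    by (cases "even k") (auto intro: convex_power_odd convex_on_subset[OF convex_power_even])
  have "(\<Sum>i\<in>I. (1 / real (card I)) *\<^sub>R x i) ^ k \<le> (\<Sum>i\<in>I. (1 / real (card I)) * x i ^ k)"
    using assms by (intro convex_on_sum[OF _ _ conv]) auto
  thus ?thesis by (simp add: sum_divide_distrib)
qed

text \<open>The function \<open>cosh \<circ> sqrt\<close> is convex because its power series has nonnegative coefficients.\<close>
lemma cosh_sqrt_mean_le:
  fixes y :: "'i \<Rightarrow> real"
  assumes I: "finite I" "I \<noteq> {}"
  shows "cosh (sqrt ((\<Sum>i\<in>I. (y i)\<^sup>2) / real (card I))) \<le> (\<Sum>i\<in>I. cosh (y i)) / real (card I)"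
proof -
  define s where "s = sqrt ((\<Sum>i\<in>I. (y i)\<^sup>2) / real (card I))"
  have s2: "s\<^sup>2 = (\<Sum>i\<in>I. (y i)\<^sup>2) / real (card I)"
    unfolding s_def by (intro real_sqrt_pow2 divide_nonneg_nonneg sum_nonneg) auto
  \<comment> \<open>Only the degrees \<open>n = 2 * k\<close> occur in the series of
    \<open>cosh\<close>; there Jensen for the \<open>k\<close>-th power is applied to the squares of
    the \<open>y i\<close>.\<close>
  have le: "(if even n then s ^ n /\<^sub>R fact n else 0)
      \<le> (\<Sum>i\<in>I. if even n then y i ^ n /\<^sub>R fact n else 0) / real (card I)" for n
  proof (cases "even n")
    case True
    then obtain k where k: "n = 2 * k" by blast
    have "s ^ n = (s\<^sup>2) ^ k" by (simp add: k power_mult)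
    also have "\<dots> \<le> (\<Sum>i\<in>I. ((y i)\<^sup>2) ^ k) / real (card I)"
      unfolding s2 by (rule power_mean_le[OF I]) simp
    also have "\<dots> = (\<Sum>i\<in>I. y i ^ n) / real (card I)" by (simp add: k power_mult)
    finally have "s ^ n / fact n \<le> (\<Sum>i\<in>I. y i ^ n) / real (card I) / fact n"
      by (rule divide_right_mono) simp
    thus ?thesis using True by (simp add: divide_inverse_commute sum_distrib_left mult_ac)
  qed simp
  show ?thesis unfolding s_def[symmetric]
    by (rule sums_le[OF le cosh_converges]) (intro sums_divide sums_sum cosh_converges)
qed

text \<open>Exponential Markov inequality with \<open>cosh\<close> of the root mean square as test
  function. Its convexity in the squares bounds it by the average of \<open>cosh\<close> of the
  single forms, whose integrals are explicit. The exponent is thus that of one Gaussian variable of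
  variance \<open>\<sigma>\<close>: \<open>card I\<close> only scales the threshold, and the forms
  may be correlated.\<close>

lemma gauss_seminorm_tail:
  fixes a :: "'i \<Rightarrow> nat \<Rightarrow> real"
  assumes I: "finite I" "I \<noteq> {}" and var: "\<And>i. i \<in> I \<Longrightarrow> (\<Sum>k<N. (a i k)\<^sup>2) \<le> \<sigma>" and pos: "\<sigma> > 0" "\<tau> \<ge> 0"
  shows "measure (gauss N) {x \<in> space (gauss N). (\<Sum>i\<in>I. (\<Sum>k<N. a i k * x k)\<^sup>2) > real (card I) * \<tau>\<^sup>2}
       \<le> 2 * exp (- \<tau>\<^sup>2 / (2 * \<sigma>))"
proof -
  interpret prob_space "gauss N" by (rule prob_space_gauss)
  define E where "E = {x \<in> space (gauss N). (\<Sum>i\<in>I. (\<Sum>k<N. a i k * x k)\<^sup>2) > real (card I) * \<tau>\<^sup>2}"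
  \<comment> \<open>The minimiser of the exponent
    \<open>- l * \<tau> + l^2 * \<sigma> / 2\<close>.\<close>
  define l where "l = \<tau> / \<sigma>"
  define n where "n = real (card I)"
  define C where "C = 2 * exp (- l * \<tau>) / n"
  have n: "n > 0" using I by (simp add: n_def card_gt_0_iff)
  have l: "l \<ge> 0" using pos by (simp add: l_def)
  have C: "C \<ge> 0" using n by (simp add: C_def)
  have E[measurable]: "E \<in> sets (gauss N)" unfolding E_def by measurable
  have ptw: "indicator E x \<le> ennreal C * (\<Sum>i\<in>I. ennreal (cosh (\<Sum>k<N. (l * a i k) * x k)))"
    if "x \<in> space (gauss N)" for x
  proof (cases "x \<in> E")
    case True
    define s where "s = sqrt ((\<Sum>i\<in>I. (\<Sum>k<N. (l * a i k) * x k)\<^sup>2) / n)"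
    have "(l * \<tau>)\<^sup>2 \<le> (\<Sum>i\<in>I. (\<Sum>k<N. (l * a i k) * x k)\<^sup>2) / n"
    proof -
      have "n * \<tau>\<^sup>2 \<le> (\<Sum>i\<in>I. (\<Sum>k<N. a i k * x k)\<^sup>2)" using True by (simp add: E_def n_def)
      hence "l\<^sup>2 * (n * \<tau>\<^sup>2) \<le> l\<^sup>2 * (\<Sum>i\<in>I. (\<Sum>k<N. a i k * x k)\<^sup>2)" by (rule mult_left_mono) simp
      also have "\<dots> = (\<Sum>i\<in>I. (\<Sum>k<N. (l * a i k) * x k)\<^sup>2)"
        by (simp add: sum_distrib_left power_mult_distrib[symmetric] mult.assoc)
      finally show ?thesis using n by (simp add: pos_le_divide_eq power_mult_distrib mult_ac)
    qed
    hence "l * \<tau> \<le> s" unfolding s_def by (rule real_le_rsqrt)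
    hence "exp (l * \<tau>) \<le> exp s" by simp
    also have "\<dots> \<le> 2 * cosh s" by (simp add: cosh_def)
    also have "cosh s \<le> (\<Sum>i\<in>I. cosh (\<Sum>k<N. (l * a i k) * x k)) / n"
      unfolding s_def n_def by (rule cosh_sqrt_mean_le[OF I])
    finally have "exp (l * \<tau>) \<le> 2 * ((\<Sum>i\<in>I. cosh (\<Sum>k<N. (l * a i k) * x k)) / n)" by simp
    hence "1 \<le> C * (\<Sum>i\<in>I. cosh (\<Sum>k<N. (l * a i k) * x k))"
    proof -
      assume *: "exp (l * \<tau>) \<le> 2 * ((\<Sum>i\<in>I. cosh (\<Sum>k<N. (l * a i k) * x k)) / n)"
      have "1 = exp (- l * \<tau>) * exp (l * \<tau>)" by (simp flip: exp_add)
      also have "\<dots> \<le> exp (- l * \<tau>) * (2 * ((\<Sum>i\<in>I. cosh (\<Sum>k<N. (l * a i k) * x k)) / n))"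
        by (intro mult_left_mono *) simp
      finally show ?thesis by (simp add: C_def mult_ac)
    qed
    hence "ennreal 1 \<le> ennreal (C * (\<Sum>i\<in>I. cosh (\<Sum>k<N. (l * a i k) * x k)))" by (rule ennreal_leI)
    also have "\<dots> = ennreal C * (\<Sum>i\<in>I. ennreal (cosh (\<Sum>k<N. (l * a i k) * x k)))"
      using C by (simp add: ennreal_mult' sum_ennreal[symmetric] del: sum_ennreal)
    finally show ?thesis using True by simp
  qed simp
  have "emeasure (gauss N) E = (\<integral>\<^sup>+x. indicator E x \<partial>gauss N)" by simp
  also have "\<dots> \<le> (\<integral>\<^sup>+x. ennreal C * (\<Sum>i\<in>I. ennreal (cosh (\<Sum>k<N. (l * a i k) * x k))) \<partial>gauss N)"
    by (rule nn_integral_mono) (rule ptw)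
  also have "\<dots> = ennreal C * (\<Sum>i\<in>I. \<integral>\<^sup>+x. ennreal (cosh (\<Sum>k<N. (l * a i k) * x k)) \<partial>gauss N)"
  proof -
    have [measurable]: "(\<lambda>x. cosh (\<Sum>k<N. (l * a i k) * x k)) \<in> borel_measurable (gauss N)" for i
      unfolding cosh_def by measurable
    show ?thesis by (subst nn_integral_cmult, measurable, subst nn_integral_sum) simp_all
  qed
  also have "\<dots> \<le> ennreal C * (\<Sum>i\<in>I. ennreal (exp (l\<^sup>2 * \<sigma> / 2)))"
  proof (intro mult_left_mono sum_mono)
    fix i assume "i \<in> I"
    have "(\<Sum>k<N. (l * a i k)\<^sup>2) = l\<^sup>2 * (\<Sum>k<N. (a i k)\<^sup>2)"
      by (simp add: power_mult_distrib sum_distrib_left)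
    also have "\<dots> \<le> l\<^sup>2 * \<sigma>" by (intro mult_left_mono var \<open>i \<in> I\<close>) simp
    finally show "(\<integral>\<^sup>+x. ennreal (cosh (\<Sum>k<N. (l * a i k) * x k)) \<partial>gauss N) \<le> ennreal (exp (l\<^sup>2 * \<sigma> / 2))"
      by (simp add: gauss_cosh_linear ennreal_leI)
  qed simp
  also have "\<dots> = ennreal (C * (n * exp (l\<^sup>2 * \<sigma> / 2)))"
    using C by (simp add: n_def ennreal_mult' ennreal_of_nat_eq_real_of_nat)
  also have "C * (n * exp (l\<^sup>2 * \<sigma> / 2)) = 2 * exp (- \<tau>\<^sup>2 / (2 * \<sigma>))"
  proof -
    have "- l * \<tau> + l\<^sup>2 * \<sigma> / 2 = - \<tau>\<^sup>2 / (2 * \<sigma>)"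
      using pos by (simp add: l_def field_simps power2_eq_square)
    thus ?thesis using n by (simp add: C_def exp_add[symmetric])
  qed
  finally have "emeasure (gauss N) E \<le> ennreal (2 * exp (- \<tau>\<^sup>2 / (2 * \<sigma>)))" .
  thus ?thesis unfolding E_def[symmetric] emeasure_eq_measure by (subst (asm) ennreal_le_iff) auto
qed

text \<open>\<open>B\<close> is the threshold at which the tail bound of each seminorm equals
  \<open>1 / (2 * card Q)\<close>, so that the union bound over \<open>Q\<close> costs one
  half.\<close>

lemma gauss_seminorm_ball_ge_half:
  fixes a :: "'m \<Rightarrow> 'i \<Rightarrow> nat \<Rightarrow> real"
  assumes Q: "finite Q" "Q \<noteq> {}" and I: "finite I" "I \<noteq> {}"
    and var: "\<And>m i. m \<in> Q \<Longrightarrow> i \<in> I \<Longrightarrow> (\<Sum>k<N. (a m i k)\<^sup>2) \<le> \<sigma>" and pos: "\<sigma> > 0"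
    and B: "B = 2 * real (card I) * \<sigma> * ln (4 * real (card Q))"
  shows "measure (gauss N) {x \<in> space (gauss N). \<forall>m\<in>Q. (\<Sum>i\<in>I. (\<Sum>k<N. a m i k * x k)\<^sup>2) \<le> B} \<ge> 1 / 2"
proof -
  interpret prob_space "gauss N" by (rule prob_space_gauss)
  define K where "K = {x \<in> space (gauss N). \<forall>m\<in>Q. (\<Sum>i\<in>I. (\<Sum>k<N. a m i k * x k)\<^sup>2) \<le> B}"
  define E where "E m = {x \<in> space (gauss N). (\<Sum>i\<in>I. (\<Sum>k<N. a m i k * x k)\<^sup>2) > B}" for m
  define \<tau> where "\<tau> = sqrt (2 * \<sigma> * ln (4 * real (card Q)))"
  have cQ: "real (card Q) \<ge> 1" using Q by (simp add: Suc_leI card_gt_0_iff)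
  have \<tau>2: "\<tau>\<^sup>2 = 2 * \<sigma> * ln (4 * real (card Q))"
    unfolding \<tau>_def using cQ pos by (intro real_sqrt_pow2 mult_nonneg_nonneg ln_ge_zero) auto
  have K[measurable]: "K \<in> sets (gauss N)" unfolding K_def using Q(1) by measurable
  have E[measurable]: "E m \<in> sets (gauss N)" for m unfolding E_def by measurable
  have "\<tau> \<ge> 0" unfolding \<tau>_def using cQ pos by (intro real_sqrt_ge_zero mult_nonneg_nonneg ln_ge_zero) auto
  have PE: "prob (E m) \<le> 1 / (2 * real (card Q))" if "m \<in> Q" for m
  proof -
    have "prob (E m) \<le> 2 * exp (- \<tau>\<^sup>2 / (2 * \<sigma>))"
      using gauss_seminorm_tail[OF I var[OF that] pos \<open>\<tau> \<ge> 0\<close>]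
      by (simp add: E_def B \<tau>2 mult_ac)
    also have "- \<tau>\<^sup>2 / (2 * \<sigma>) = - ln (4 * real (card Q))" using pos by (simp add: \<tau>2)
    also have "2 * exp \<dots> = 1 / (2 * real (card Q))" using cQ by (simp add: exp_minus field_simps)
    finally show ?thesis .
  qed
  have "space (gauss N) - K = (\<Union>m\<in>Q. E m)" by (auto simp: K_def E_def not_le)
  hence "prob (space (gauss N) - K) \<le> (\<Sum>m\<in>Q. prob (E m))"
    using finite_measure_subadditive_finite[OF Q(1), of E] E by (simp add: image_subset_iff)
  also have "\<dots> \<le> (\<Sum>m\<in>Q. 1 / (2 * real (card Q)))" by (rule sum_mono) (rule PE)
  also have "\<dots> = 1 / 2" using cQ by simp
  finally show ?thesis unfolding K_def[symmetric] using prob_compl[OF K] by simp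
qed

text \<open>Averaging the shifts by \<open>a\<close> and \<open>- a\<close> turns the density into \<open>cosh \<ge> 1\<close>, so that \<open>K\<close> need not be symmetric.\<close>
lemma gauss_shift_pair_ge:
  fixes a :: "nat \<Rightarrow> real"
  assumes K: "K \<in> sets (gauss N)"
  shows "2 * exp (- (\<Sum>i<N. (a i)\<^sup>2) / 2) * measure (gauss N) K
    \<le> measure (gauss N) ((\<lambda>x. \<lambda>i\<in>{..<N}. x i + a i) -` K \<inter> space (gauss N))
      + measure (gauss N) ((\<lambda>x. \<lambda>i\<in>{..<N}. x i + - a i) -` K \<inter> space (gauss N))"
proof -
  interpret prob_space "gauss N" by (rule prob_space_gauss)
  note K[measurable]
  define s where "s = (\<Sum>i<N. (a i)\<^sup>2) / 2"
  have shift: "ennreal (measure (gauss N) ((\<lambda>x. \<lambda>i\<in>{..<N}. x i + b i) -` K \<inter> space (gauss N)))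
      = (\<integral>\<^sup>+x. ennreal (exp ((\<Sum>i<N. b i * x i) - (\<Sum>i<N. (b i)\<^sup>2) / 2)) * indicator K x \<partial>gauss N)" for b
  proof -
    have meas: "(\<lambda>x. \<lambda>i\<in>{..<N}. x i + b i) \<in> gauss N \<rightarrow>\<^sub>M gauss N" by measurable
    have "emeasure (gauss N) ((\<lambda>x. \<lambda>i\<in>{..<N}. x i + b i) -` K \<inter> space (gauss N))
        = emeasure (distr (gauss N) (gauss N) (\<lambda>x. \<lambda>i\<in>{..<N}. x i + b i)) K"
      by (rule emeasure_distr[OF meas K, symmetric])
    also have "\<dots> = (\<integral>\<^sup>+x. ennreal (exp ((\<Sum>i<N. b i * x i) - (\<Sum>i<N. (b i)\<^sup>2) / 2)) * indicator K x \<partial>gauss N)"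
      unfolding gauss_shift using K by (subst emeasure_density) auto
    finally show ?thesis by (simp add: emeasure_eq_measure)
  qed
  have ptw: "ennreal (2 * exp (- s)) * indicator K x
      \<le> ennreal (exp ((\<Sum>i<N. a i * x i) - (\<Sum>i<N. (a i)\<^sup>2) / 2)) * indicator K x
      + ennreal (exp ((\<Sum>i<N. - a i * x i) - (\<Sum>i<N. (- a i)\<^sup>2) / 2)) * indicator K x" for x
  proof -
    have "2 * exp (- s) \<le> (2 * cosh (\<Sum>i<N. a i * x i)) * exp (- s)"
      by (intro mult_right_mono) (auto simp: cosh_real_ge_1)
    also have "\<dots> = exp ((\<Sum>i<N. a i * x i) - (\<Sum>i<N. (a i)\<^sup>2) / 2) + exp ((\<Sum>i<N. - a i * x i) - (\<Sum>i<N. (- a i)\<^sup>2) / 2)"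
    proof -
      have "(\<Sum>i<N. - a i * x i) = - (\<Sum>i<N. a i * x i)" "(\<Sum>i<N. (- a i)\<^sup>2) / 2 = s"
        by (simp_all add: s_def sum_negf)
      moreover have "(2 * cosh u) * exp (- s) = exp (u - s) + exp (- u - s)" for u :: real
      proof -
        have "2 * cosh u = exp u + exp (- u)" by (simp add: cosh_def)
        moreover have "exp u * exp (- s) = exp (u - s)" "exp (- u) * exp (- s) = exp (- u - s)"
          by (simp_all flip: exp_add)
        ultimately show ?thesis by (simp only: distrib_right)
      qed
      ultimately show ?thesis by (simp only: s_def)
    qed
    finally have "ennreal (2 * exp (- s)) \<le> ennreal (exp ((\<Sum>i<N. a i * x i) - (\<Sum>i<N. (a i)\<^sup>2) / 2))
      + ennreal (exp ((\<Sum>i<N. - a i * x i) - (\<Sum>i<N. (- a i)\<^sup>2) / 2))"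
      unfolding ennreal_plus[OF exp_ge_zero exp_ge_zero, symmetric] by (rule ennreal_leI)
    thus ?thesis unfolding distrib_right[symmetric] by (rule mult_right_mono) simp
  qed
  have "ennreal (2 * exp (- s) * measure (gauss N) K) = (\<integral>\<^sup>+x. ennreal (2 * exp (- s)) * indicator K x \<partial>gauss N)"
    by (simp add: nn_integral_cmult_indicator emeasure_eq_measure ennreal_mult'')
  also have "\<dots> \<le> (\<integral>\<^sup>+x. ennreal (exp ((\<Sum>i<N. a i * x i) - (\<Sum>i<N. (a i)\<^sup>2) / 2)) * indicator K x
      + ennreal (exp ((\<Sum>i<N. - a i * x i) - (\<Sum>i<N. (- a i)\<^sup>2) / 2)) * indicator K x \<partial>gauss N)"
    by (rule nn_integral_mono) (rule ptw)
  also have "\<dots> = ennreal (measure (gauss N) ((\<lambda>x. \<lambda>i\<in>{..<N}. x i + a i) -` K \<inter> space (gauss N)))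
      + ennreal (measure (gauss N) ((\<lambda>x. \<lambda>i\<in>{..<N}. x i + - a i) -` K \<inter> space (gauss N)))"
    unfolding shift by (subst nn_integral_add) auto
  finally show ?thesis
    by (simp add: s_def flip: ennreal_plus)
qed

lemma square_diff_le: "(a - b)\<^sup>2 \<le> 2 * a\<^sup>2 + 2 * (b::real)\<^sup>2"
proof -
  have "0 \<le> (a + b)\<^sup>2" by simp
  thus ?thesis by (simp add: power2_eq_square algebra_simps)
qed

text \<open>Dilating the separated set by \<open>l\<close> makes the translates of the Gaussian ball
  \<open>K\<close> disjoint. By Cameron-Martin the translates by \<open>l * x\<close> and
  \<open>- l * x\<close> together still have mass at least \<open>exp (- l^2 / 2)\<close>, since
  \<open>K\<close> has mass at least one half and \<open>x\<close> has norm at most one. The two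
  families have total mass at most 2, and \<open>l^2 / 2 = 2 * B / D\<close>.\<close>

lemma dual_sudakov_separated_card_le:
  fixes a :: "'m \<Rightarrow> 'i \<Rightarrow> nat \<Rightarrow> real" and S :: "(nat \<Rightarrow> real) set"
  assumes Q: "finite Q" "Q \<noteq> {}" and I: "finite I" "I \<noteq> {}"
    and var: "\<And>m i. m \<in> Q \<Longrightarrow> i \<in> I \<Longrightarrow> (\<Sum>k<N. (a m i k)\<^sup>2) \<le> \<sigma>" and pos: "\<sigma> > 0"
    and B: "B = 2 * real (card I) * \<sigma> * ln (4 * real (card Q))" and D: "D > 0"
    and S: "finite S" "\<And>x. x \<in> S \<Longrightarrow> (\<Sum>k<N. (x k)\<^sup>2) \<le> 1"
    and sep: "\<And>x y. x \<in> S \<Longrightarrow> y \<in> S \<Longrightarrow> x \<noteq> y \<Longrightarrow>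
        \<exists>m\<in>Q. (\<Sum>i\<in>I. (\<Sum>k<N. a m i k * (x k - y k))\<^sup>2) > D"
  shows "real (card S) \<le> 2 * exp (2 * B / D)"
proof -
  interpret prob_space "gauss N" by (rule prob_space_gauss)
  define K where "K = {x \<in> space (gauss N). \<forall>m\<in>Q. (\<Sum>i\<in>I. (\<Sum>k<N. a m i k * x k)\<^sup>2) \<le> B}"
  \<comment> \<open>Two points of \<open>K\<close> differ by an energy of at most
    \<open>2 * B + 2 * B\<close>. With \<open>l^2 * D = 4 * B\<close> a common point of two
    translates would contradict the strict separation by \<open>D\<close>.\<close>
  define l where "l = sqrt (4 * B / D)"
  have cQ: "real (card Q) \<ge> 1" using Q by (simp add: Suc_leI card_gt_0_iff)
  have B0: "B > 0" unfolding B using cQ pos I by (intro mult_pos_pos ln_gt_zero) (auto simp: card_gt_0_iff)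
  have l2: "l\<^sup>2 = 4 * B / D" unfolding l_def using B0 D by simp
  have l0: "l > 0" unfolding l_def using B0 D by simp
  have K[measurable]: "K \<in> sets (gauss N)" unfolding K_def using Q(1) by measurable
  have K_half: "prob K \<ge> 1 / 2"
    unfolding K_def by (rule gauss_seminorm_ball_ge_half[OF Q I var pos B])
  define F where "F c x = (\<lambda>z. \<lambda>i\<in>{..<N}. z i + c * x i) -` K \<inter> space (gauss N)" for c and x :: "nat \<Rightarrow> real"
  have F_meas: "F c x \<in> sets (gauss N)" for c x
    unfolding F_def by (rule measurable_sets[OF _ K]) measurable
  have F_iff: "z \<in> F c x \<longleftrightarrow> z \<in> space (gauss N) \<and> (\<forall>m\<in>Q. (\<Sum>i\<in>I. (\<Sum>k<N. a m i k * (z k + c * x k))\<^sup>2) \<le> B)" for z c x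
    by (auto simp: F_def K_def space_gauss)
  have disj: "disjoint_family_on (F c) S" if c: "c\<^sup>2 = l\<^sup>2" for c
  proof (unfold disjoint_family_on_def, intro ballI impI)
    fix x y assume xy: "x \<in> S" "y \<in> S" "x \<noteq> y"
    then obtain m where m: "m \<in> Q" "(\<Sum>i\<in>I. (\<Sum>k<N. a m i k * (x k - y k))\<^sup>2) > D" using sep by blast
    show "F c x \<inter> F c y = {}"
    proof (rule ccontr)
      assume "F c x \<inter> F c y \<noteq> {}"
      then obtain z where z: "z \<in> F c x" "z \<in> F c y" by blast
      define p where "p i = (\<Sum>k<N. a m i k * (z k + c * x k))" for i
      define q where "q i = (\<Sum>k<N. a m i k * (z k + c * y k))" for i
      have p: "(\<Sum>i\<in>I. (p i)\<^sup>2) \<le> B" and q: "(\<Sum>i\<in>I. (q i)\<^sup>2) \<le> B"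
        using z m(1) by (auto simp: F_iff p_def q_def)
      have pq: "c * (\<Sum>k<N. a m i k * (x k - y k)) = p i - q i" for i
        by (simp add: p_def q_def sum_distrib_left sum_subtractf[symmetric] algebra_simps)
      have "l\<^sup>2 * (\<Sum>i\<in>I. (\<Sum>k<N. a m i k * (x k - y k))\<^sup>2) = (\<Sum>i\<in>I. (p i - q i)\<^sup>2)"
        unfolding c[symmetric] sum_distrib_left[of "c\<^sup>2"] power_mult_distrib[symmetric] pq ..
      also have "\<dots> \<le> (\<Sum>i\<in>I. 2 * (p i)\<^sup>2 + 2 * (q i)\<^sup>2)"
        by (intro sum_mono square_diff_le)
      also have "\<dots> \<le> 4 * B" using p q by (simp add: sum.distrib sum_distrib_left[symmetric])
      also have "\<dots> = l\<^sup>2 * D" using D by (simp add: l2)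
      finally show False using m(2) l0 by simp
    qed
  qed
  have sum_le1: "(\<Sum>x\<in>S. prob (F c x)) \<le> 1" if "c\<^sup>2 = l\<^sup>2" for c
  proof -
    have "(\<Sum>x\<in>S. prob (F c x)) = prob (\<Union>x\<in>S. F c x)"
      using S(1) disj[OF that] F_meas by (intro finite_measure_finite_Union[symmetric]) auto
    thus ?thesis by simp
  qed
  have each: "exp (- (2 * B / D)) \<le> prob (F l x) + prob (F (- l) x)" if "x \<in> S" for x
  proof -
    have "(\<Sum>i<N. (l * x i)\<^sup>2) = l\<^sup>2 * (\<Sum>i<N. (x i)\<^sup>2)"
      by (simp add: power_mult_distrib sum_distrib_left)
    also have "\<dots> \<le> l\<^sup>2 * 1" by (intro mult_left_mono S(2) that) simp
    finally have "exp (- (2 * B / D)) \<le> exp (- (\<Sum>i<N. (l * x i)\<^sup>2) / 2)" by (simp add: l2)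
    also have "\<dots> \<le> 2 * exp (- (\<Sum>i<N. (l * x i)\<^sup>2) / 2) * prob K"
      using K_half mult_left_mono[of "1/2" "prob K" "2 * exp (- (\<Sum>i<N. (l * x i)\<^sup>2) / 2)"] by simp
    also have "\<dots> \<le> prob (F l x) + prob (F (- l) x)"
      using gauss_shift_pair_ge[OF K, of "\<lambda>i. l * x i"] by (simp add: F_def)
    finally show ?thesis .
  qed
  have "real (card S) * exp (- (2 * B / D)) = (\<Sum>x\<in>S. exp (- (2 * B / D)))" by simp
  also have "\<dots> \<le> (\<Sum>x\<in>S. prob (F l x) + prob (F (- l) x))" by (rule sum_mono) (rule each)
  also have "\<dots> \<le> 2" using sum_le1[of l] sum_le1[of "- l"] by (simp add: sum.distrib)
  finally show ?thesis by (simp add: exp_minus field_simps)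
qed

section \<open>Entropy numbers and the functional \<open>gamma2\<close>\<close>

lemma sum_half_power_abs:
  "(\<Sum>j\<in>{- int m..int m}. (1 / 2 :: real) ^ nat \<bar>j\<bar>) = 3 - 2 * (1 / 2) ^ m"
proof (induction m)
  case (Suc m)
  have "{- int (Suc m)..int (Suc m)} = insert (int (Suc m)) (insert (- int (Suc m)) {- int m..int m})" by auto
  thus ?case by (simp add: Suc.IH nat_add_distrib add.commute)
qed simp

text \<open>Generating function argument: with weight \<open>(1 / 2) ^ \<bar>z i\<bar>\<close> in
  each coordinate, every point of the ball weighs at least \<open>(1 / 2) ^ m\<close>, while the
  whole box weighs at most \<open>3 ^ N\<close> because the weight factorises.\<close>

lemma card_lattice_l1_ball_le:
  "real (card {z \<in> {..<N} \<rightarrow>\<^sub>E {- int m..int m}. (\<Sum>i<N. \<bar>z i\<bar>) \<le> int m}) \<le> 2 ^ m * 3 ^ N"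
proof -
  let ?P = "{..<N} \<rightarrow>\<^sub>E {- int m..int m}"
  let ?Z = "{z \<in> ?P. (\<Sum>i<N. \<bar>z i\<bar>) \<le> int m}"
  have fin: "finite ?P" by (intro finite_PiE) auto
  have w: "(\<Prod>i<N. (1 / 2 :: real) ^ nat \<bar>z i\<bar>) = (1 / 2) ^ nat (\<Sum>i<N. \<bar>z i\<bar>)" for z :: "nat \<Rightarrow> int"
  proof -
    have "int (\<Sum>i<N. nat \<bar>z i\<bar>) = (\<Sum>i<N. \<bar>z i\<bar>)" by simp
    hence "nat (\<Sum>i<N. \<bar>z i\<bar>) = (\<Sum>i<N. nat \<bar>z i\<bar>)" by (metis nat_int)
    thus ?thesis by (simp add: power_sum)
  qed
  have "real (card ?Z) * (1 / 2) ^ m = (\<Sum>z\<in>?Z. (1 / 2) ^ m)" by simp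
  also have "\<dots> \<le> (\<Sum>z\<in>?Z. \<Prod>i<N. (1 / 2 :: real) ^ nat \<bar>z i\<bar>)"
    unfolding w by (intro sum_mono power_decreasing) (simp_all add: nat_le_iff)
  also have "\<dots> \<le> (\<Sum>z\<in>?P. \<Prod>i<N. (1 / 2 :: real) ^ nat \<bar>z i\<bar>)"
    using fin by (intro sum_mono2 prod_nonneg) auto
  also have "\<dots> = (\<Prod>i<N. \<Sum>j\<in>{- int m..int m}. (1 / 2 :: real) ^ nat \<bar>j\<bar>)"
    by (rule prod_sum_PiE[symmetric]) auto
  also have "\<dots> \<le> (\<Prod>i<N. 3)"
    by (intro prod_mono conjI sum_nonneg) (simp_all add: sum_half_power_abs)
  finally have "real (card ?Z) * (1 / 2) ^ m \<le> 3 ^ N" by simp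
  hence "2 ^ m * (real (card ?Z) * (1 / 2) ^ m) \<le> 2 ^ m * 3 ^ N" by (rule mult_left_mono) simp
  thus ?thesis by (simp add: power_divide)
qed

section \<open>Coverings and entropy numbers\<close>

text \<open>An entropy-number bound in the form of a labelling: the fibres of \<open>f\<close> are
  the cells, and \<open>\<delta>\<close> bounds their diameter and not a radius. Labels make common
  refinements easy to define and to count.\<close>

definition coverable :: "'a set \<Rightarrow> ('a \<Rightarrow> 'a \<Rightarrow> real) \<Rightarrow> nat \<Rightarrow> real \<Rightarrow> bool" where
  "coverable X d n \<delta> \<longleftrightarrow> (\<exists>f::'a \<Rightarrow> nat. f ` X \<subseteq> {..<n} \<and> (\<forall>x\<in>X. \<forall>y\<in>X. f x = f y \<longrightarrow> d x y \<le> \<delta>))"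

lemma coverableI:
  fixes f :: "'a \<Rightarrow> 'b"
  assumes "finite (f ` X)" "card (f ` X) \<le> n" "\<And>x y. x \<in> X \<Longrightarrow> y \<in> X \<Longrightarrow> f x = f y \<Longrightarrow> d x y \<le> \<delta>"
  shows "coverable X d n \<delta>"
proof -
  obtain h where h: "bij_betw h (f ` X) {0..<card (f ` X)}"
    using ex_bij_betw_finite_nat[OF assms(1)] by blast
  have "(h \<circ> f) ` X \<subseteq> {..<n}"
    unfolding image_comp[symmetric] bij_betw_imp_surj_on[OF h] using assms(2) by auto
  moreover have "d x y \<le> \<delta>" if "x \<in> X" "y \<in> X" "(h \<circ> f) x = (h \<circ> f) y" for x y
    using assms(3)[OF that(1,2)] that bij_betw_imp_inj_on[OF h] by (auto simp: inj_on_def)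
  ultimately show ?thesis unfolding coverable_def by blast
qed

lemma coverable_trivial:
  assumes "n \<ge> 1" "\<And>x y. x \<in> X \<Longrightarrow> y \<in> X \<Longrightarrow> d x y \<le> \<delta>"
  shows "coverable X d n \<delta>"
  unfolding coverable_def using assms by (intro exI[of _ "\<lambda>_. 0"]) auto

text \<open>Take a separated set of greatest cardinality and send each point to a chosen near
  element of it. Nearness is an abstract relation, so that it can be stated with squared forms; the
  triangle inequality enters only through the last hypothesis.\<close>

lemma coverable_if_separated_card_le:
  fixes near :: "'a \<Rightarrow> 'a \<Rightarrow> bool"
  assumes refl: "\<And>x. x \<in> X \<Longrightarrow> near x x" and sym: "\<And>x y. near x y \<Longrightarrow> near y x"
    and sep: "\<And>S. finite S \<Longrightarrow> S \<subseteq> X \<Longrightarrow> (\<And>x y. x \<in> S \<Longrightarrow> y \<in> S \<Longrightarrow> x \<noteq> y \<Longrightarrow> \<not> near x y) \<Longrightarrow> card S \<le> n"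
    and d: "\<And>x y z. x \<in> X \<Longrightarrow> y \<in> X \<Longrightarrow> z \<in> X \<Longrightarrow> near x z \<Longrightarrow> near y z \<Longrightarrow> d x y \<le> \<delta>"
  shows "coverable X d n \<delta>"
proof -
  define P where "P S \<longleftrightarrow> finite S \<and> S \<subseteq> X \<and> (\<forall>x\<in>S. \<forall>y\<in>S. x \<noteq> y \<longrightarrow> \<not> near x y)" for S
  have "P {}" by (simp add: P_def)
  moreover have "card S < Suc n" if "P S" for S
    using sep[of S] that unfolding P_def by (meson le_imp_less_Suc)
  ultimately obtain S where S: "P S" "\<And>S'. P S' \<Longrightarrow> card S' \<le> card S"
    using ex_has_greatest_nat[of P "{}" card "Suc n"] by blast
  have ex: "\<exists>s\<in>S. near x s" if "x \<in> X" for x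
  proof (rule ccontr)
    assume *: "\<not> (\<exists>s\<in>S. near x s)"
    hence "x \<notin> S" using refl[OF that] by blast
    moreover have "P (insert x S)" using S(1) * that sym unfolding P_def by blast
    ultimately show False using S(1) S(2)[of "insert x S"] by (simp add: P_def)
  qed
  define f where "f x = (SOME s. s \<in> S \<and> near x s)" for x
  have f: "f x \<in> S" "near x (f x)" if "x \<in> X" for x
    using someI_ex[of "\<lambda>s. s \<in> S \<and> near x s"] ex[OF that] by (auto simp: f_def)
  have im: "f ` X \<subseteq> S" using f by blast
  show ?thesis
  proof (rule coverableI[of f])
    show "finite (f ` X)" using im S(1) finite_subset by (auto simp: P_def)
    show "card (f ` X) \<le> n"
      using card_mono[OF _ im] sep[of S] S(1) unfolding P_def by (meson order_trans)
    fix x y assume "x \<in> X" "y \<in> X" "f x = f y"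
    thus "d x y \<le> \<delta>" using f[of x] f[of y] S(1) by (intro d[of x y "f x"]) (auto simp: P_def)
  qed
qed

lemma coverable_mono:
  assumes "coverable X d n \<delta>" "\<And>x y. x \<in> X \<Longrightarrow> y \<in> X \<Longrightarrow> d x y \<le> \<delta> \<Longrightarrow> d' x y \<le> \<delta>'"
  shows "coverable X d' n \<delta>'"
proof -
  from assms(1) obtain f :: "'a \<Rightarrow> nat" where f: "f ` X \<subseteq> {..<n}"
    "\<And>x y. x \<in> X \<Longrightarrow> y \<in> X \<Longrightarrow> f x = f y \<Longrightarrow> d x y \<le> \<delta>"
    unfolding coverable_def by blast
  show ?thesis unfolding coverable_def
    by (intro exI[of _ f] conjI ballI impI f(1) assms(2) f(2))
qed

text \<open>Round to a grid of mesh \<open>h\<close>. The sphere has l1 radius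
  \<open>sqrt N\<close>, so the rounded points lie in an l1 ball of radius
  \<open>sqrt N / h + N\<close>, and its lattice points are few enough. A decay of
  \<open>1 / 2 ^ k\<close>, much weaker than a volume estimate gives, is enough: after
  multiplication by \<open>2 ^ (k / 2)\<close> it is still geometric.\<close>

lemma coverable_unit_sphere_l2:
  assumes N: "N \<ge> 1" and k: "4 * N \<le> 2 ^ k"
  shows "coverable (unit_sphere N) (\<lambda>x y. sqrt (\<Sum>i<N. (x i - y i)\<^sup>2)) (2 ^ (2 ^ k)) (4 * real N / 2 ^ k)"
proof -
  define h where "h = 4 * sqrt (real N) / 2 ^ k"
  have h: "h > 0" using N by (simp add: h_def)
  define f where "f x = (\<lambda>i\<in>{..<N}. \<lfloor>x i / h\<rfloor>)" for x :: "nat \<Rightarrow> real"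
  have k2: "k \<ge> 2"
  proof (rule ccontr)
    assume "\<not> k \<ge> 2"
    hence "k = 0 \<or> k = 1" by auto
    thus False using k N by auto
  qed
  define m where "m = 2 ^ (k - 2) + N"
  have pk: "(2::nat) ^ k = 4 * 2 ^ (k - 2)"
  proof -
    obtain q where "k = 2 + q" using k2 le_Suc_ex by blast
    thus ?thesis by (simp add: power_add)
  qed
  let ?Z = "{z \<in> {..<N} \<rightarrow>\<^sub>E {- int m..int m}. (\<Sum>i<N. \<bar>z i\<bar>) \<le> int m}"
  have finZ: "finite ?Z" by (rule finite_subset[of _ "{..<N} \<rightarrow>\<^sub>E {- int m..int m}"]) (auto intro: finite_PiE)
  have im: "f ` unit_sphere N \<subseteq> ?Z"
  proof (rule image_subsetI)
    fix x assume "x \<in> unit_sphere N"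
    hence x: "(\<Sum>k<N. (x k)\<^sup>2) = 1" by (simp add: unit_sphere_def)
    have "(\<Sum>i<N. \<bar>x i\<bar>) \<le> sqrt (real N)"
    proof -
      have "(\<Sum>i<N. 1 * \<bar>x i\<bar>)\<^sup>2 \<le> (\<Sum>i<N. 1\<^sup>2) * (\<Sum>i<N. \<bar>x i\<bar>\<^sup>2)" by (rule Cauchy_Schwarz_ineq_sum)
      thus ?thesis using x by (intro real_le_rsqrt) simp
    qed
    hence "(\<Sum>i<N. \<bar>x i\<bar>) / h \<le> sqrt (real N) / h" using h by (simp add: divide_right_mono)
    also have "\<dots> = 2 ^ k / 4" using N by (simp add: h_def)
    also have "\<dots> = 2 ^ (k - 2)" using pk by (metis nonzero_mult_div_cancel_left of_nat_mult of_nat_numeral of_nat_power zero_neq_numeral)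
    finally have l1: "(\<Sum>i<N. \<bar>x i\<bar>) / h \<le> 2 ^ (k - 2)" .
    have "real_of_int (\<Sum>i<N. \<bar>\<lfloor>x i / h\<rfloor>\<bar>) \<le> (\<Sum>i<N. \<bar>x i\<bar> / h + 1)"
      unfolding of_int_sum
    proof (rule sum_mono)
      fix i
      have "\<bar>real_of_int \<lfloor>x i / h\<rfloor>\<bar> \<le> \<bar>x i / h\<bar> + 1" by linarith
      thus "real_of_int \<bar>\<lfloor>x i / h\<rfloor>\<bar> \<le> \<bar>x i\<bar> / h + 1" using h by simp
    qed
    also have "\<dots> = (\<Sum>i<N. \<bar>x i\<bar>) / h + real N" by (simp add: sum.distrib sum_divide_distrib)
    also have "\<dots> \<le> real m" using l1 by (simp add: m_def)
    finally have s: "(\<Sum>i<N. \<bar>\<lfloor>x i / h\<rfloor>\<bar>) \<le> int m" by linarith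
    have "\<lfloor>x i / h\<rfloor> \<in> {- int m..int m}" if "i < N" for i
    proof -
      have "\<bar>\<lfloor>x i / h\<rfloor>\<bar> \<le> (\<Sum>i<N. \<bar>\<lfloor>x i / h\<rfloor>\<bar>)"
        using that by (intro member_le_sum[where f="\<lambda>i. \<bar>\<lfloor>x i / h\<rfloor>\<bar>"]) auto
      thus ?thesis using s by auto
    qed
    thus "f x \<in> ?Z" using s by (auto simp: f_def)
  qed
  show ?thesis
  proof (rule coverableI[of f])
    show "finite (f ` unit_sphere N)" by (rule finite_subset[OF im finZ])
    have "real (card (f ` unit_sphere N)) \<le> real (card ?Z)" by (intro of_nat_mono card_mono[OF finZ im])
    also have "\<dots> \<le> 2 ^ m * 3 ^ N" by (rule card_lattice_l1_ball_le)
    also have "\<dots> \<le> 2 ^ m * 4 ^ N" by (intro mult_left_mono power_mono) auto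
    also have "\<dots> = 2 ^ (m + 2 * N)" by (simp add: power_add power_mult)
    \<comment> \<open>The exponent is \<open>2 ^ (k - 2) + 3 * N\<close>, and the hypothesis says
      \<open>N \<le> 2 ^ (k - 2)\<close>; the mesh \<open>h\<close> is chosen for this
      balance.\<close>
    also have "\<dots> \<le> 2 ^ (2 ^ k)"
      using k pk by (intro power_increasing) (auto simp: m_def)
    finally show "card (f ` unit_sphere N) \<le> 2 ^ 2 ^ k"
      by (metis of_nat_le_iff of_nat_numeral of_nat_power)
    fix x y assume eq: "f x = f y"
    have "(x i - y i)\<^sup>2 \<le> h\<^sup>2" if "i < N" for i
    proof -
      have "\<lfloor>x i / h\<rfloor> = \<lfloor>y i / h\<rfloor>" using fun_cong[OF eq, of i] that by (simp add: f_def)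
      hence "\<bar>x i / h - y i / h\<bar> \<le> 1" by linarith
      hence "\<bar>x i - y i\<bar> \<le> h" using h by (simp add: diff_divide_distrib[symmetric])
      thus ?thesis using h by (simp add: abs_le_square_iff[symmetric])
    qed
    hence "(\<Sum>i<N. (x i - y i)\<^sup>2) \<le> (\<Sum>i<N. h\<^sup>2)" by (intro sum_mono) auto
    also have "\<dots> = (sqrt (real N) * h)\<^sup>2" by (simp add: power_mult_distrib)
    finally have "sqrt (\<Sum>i<N. (x i - y i)\<^sup>2) \<le> sqrt (real N) * h"
      using h by (intro real_le_lsqrt sum_nonneg) auto
    also have "\<dots> = 4 * real N / 2 ^ k" by (simp add: h_def)
    finally show "sqrt (\<Sum>i<N. (x i - y i)\<^sup>2) \<le> 4 * real N / 2 ^ k" .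
  qed
qed

section \<open>Chaining: from coverings to \<open>gamma2\<close>\<close>

text \<open>The cells of level \<open>n\<close> are the classes of points with equal labels at all
  levels below \<open>n\<close>. They are nested by construction, and their number is at most the
  product of the \<open>2 ^ (2 ^ k)\<close> for \<open>k < n\<close>, that is
  \<open>2 ^ (2 ^ n - 1)\<close>. The price is a shift by one: level \<open>Suc k\<close> has
  diameter \<open>\<delta> k\<close>, and level 0, the single cell \<open>X\<close>, pays
  \<open>D\<close>.\<close>

lemma gamma2_le_suminf:
  fixes X :: "'a set" and d :: "'a \<Rightarrow> 'a \<Rightarrow> real"
  assumes X: "X \<noteq> {}" and cov: "\<And>k. coverable X d (2 ^ (2 ^ k)) (\<delta> k)"
    and D: "\<And>x y. x \<in> X \<Longrightarrow> y \<in> X \<Longrightarrow> d x y \<le> D"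
    and nonneg: "D \<ge> 0" "\<And>k. \<delta> k \<ge> 0"
    and summ: "summable (\<lambda>k. sqrt 2 ^ Suc k * \<delta> k)"
  shows "gamma2 X d \<le> ennreal (D + (\<Sum>k. sqrt 2 ^ Suc k * \<delta> k))"
proof -
  from cov obtain f :: "nat \<Rightarrow> 'a \<Rightarrow> nat" where
    f: "\<And>k. f k ` X \<subseteq> {..<2 ^ (2 ^ k)}" "\<And>k x y. x \<in> X \<Longrightarrow> y \<in> X \<Longrightarrow> f k x = f k y \<Longrightarrow> d x y \<le> \<delta> k"
    unfolding coverable_def by metis
  define c where "c n x = {y \<in> X. \<forall>k<n. f k y = f k x}" for n x
  define A where "A n = c n ` X" for n
  have part: "is_partition X (A n)" for n
    unfolding is_partition_def A_def c_def by fastforce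
  have cell: "cell A n x = c n x" if "x \<in> X" for n x
    unfolding cell_def
  proof (rule the_equality)
    show "c n x \<in> A n \<and> x \<in> c n x" using that by (auto simp: A_def c_def)
  next
    fix B assume "B \<in> A n \<and> x \<in> B"
    thus "B = c n x" by (auto simp: A_def c_def)
  qed
  have sub: "A n \<subseteq> (\<lambda>s. {y \<in> X. \<forall>k<n. f k y = s k}) ` (\<Pi>\<^sub>E k\<in>{..<n}. {..<2 ^ (2 ^ k)})" for n
  proof
    fix B assume "B \<in> A n"
    then obtain x where x: "x \<in> X" "B = c n x" by (auto simp: A_def)
    have "B = (\<lambda>s. {y \<in> X. \<forall>k<n. f k y = s k}) (\<lambda>k\<in>{..<n}. f k x)" by (auto simp: x c_def)
    moreover have "(\<lambda>k\<in>{..<n}. f k x) \<in> (\<Pi>\<^sub>E k\<in>{..<n}. {..<2 ^ (2 ^ k)})" using f(1) x by auto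
    ultimately show "B \<in> (\<lambda>s. {y \<in> X. \<forall>k<n. f k y = s k}) ` (\<Pi>\<^sub>E k\<in>{..<n}. {..<2 ^ (2 ^ k)})" by blast
  qed
  have finP: "finite (\<Pi>\<^sub>E k\<in>{..<n}. {..<2 ^ (2 ^ k) :: nat})" for n :: nat by (intro finite_PiE) auto
  have finA: "finite (A n)" for n by (rule finite_subset[OF sub]) (use finP in auto)
  have cardA: "card (A n) \<le> 2 ^ (2 ^ n)" for n
  proof -
    have "card (A n) \<le> card (\<Pi>\<^sub>E k\<in>{..<n}. {..<2 ^ (2 ^ k) :: nat})"
      by (rule order_trans[OF card_mono[OF finite_imageI[OF finP] sub] card_image_le[OF finP]])
    also have "\<dots> = 2 ^ (\<Sum>k<n. 2 ^ k)" by (simp add: card_PiE power_sum)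
    also have "\<dots> \<le> 2 ^ (2 ^ n)"
      by (intro power_increasing) (auto simp: sum_power2[unfolded atLeast0LessThan])
    finally show ?thesis .
  qed
  have "A 0 = {X}" using X by (auto simp: A_def c_def)
  moreover have "\<exists>C\<in>A n. B \<subseteq> C" if "B \<in> A (Suc n)" for n B
    using that by (auto simp: A_def c_def)
  ultimately have adm: "admissible X A"
    unfolding admissible_def using part finA cardA by auto
  define b where "b n = (case n of 0 \<Rightarrow> D | Suc k \<Rightarrow> sqrt 2 ^ Suc k * \<delta> k)" for n
  have b0: "b n \<ge> 0" for n using nonneg by (auto simp: b_def split: nat.split)
  have summb: "summable b" using summ by (subst summable_Suc_iff[symmetric]) (simp add: b_def)
  have diam: "2 powr (real n / 2) * diam_d d (cell A n x) \<le> b n" if x: "x \<in> X" for n x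
  proof -
    have r: "2 powr (real n / 2) = sqrt 2 ^ n"
      by (simp add: powr_half_sqrt[symmetric] powr_powr powr_realpow[symmetric])
    have ne: "{d y z | y z. y \<in> c n x \<and> z \<in> c n x} \<noteq> {}" using x by (auto simp: c_def)
    have "diam_d d (cell A n x) \<le> (case n of 0 \<Rightarrow> D | Suc k \<Rightarrow> \<delta> k)"
      unfolding cell[OF x] diam_d_def
      by (rule cSup_least[OF ne]) (use D f(2) in \<open>auto simp: c_def split: nat.split\<close>)
    hence "sqrt 2 ^ n * diam_d d (cell A n x) \<le> sqrt 2 ^ n * (case n of 0 \<Rightarrow> D | Suc k \<Rightarrow> \<delta> k)"
      by (rule mult_left_mono) simp
    thus ?thesis unfolding r by (simp add: b_def split: nat.splits)
  qed
  have "gamma2 X d \<le> (SUP x\<in>X. \<Sum>n. ennreal (2 powr (real n / 2) * diam_d d (cell A n x)))"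
    unfolding gamma2_def by (rule INF_lower) (use adm in auto)
  also have "\<dots> \<le> (\<Sum>n. ennreal (b n))"
    by (intro SUP_least suminf_le ennreal_leI diam) auto
  also have "\<dots> = ennreal (\<Sum>n. b n)" by (rule suminf_ennreal2[OF b0 summb])
  also have "(\<Sum>n. b n) = D + (\<Sum>k. sqrt 2 ^ Suc k * \<delta> k)"
    using suminf_split_head[OF summb] by (simp add: b_def[of "Suc _"] b_def[of 0])
  finally show ?thesis .
qed

lemma gamma2_le_split:
  fixes X :: "'a set" and d :: "'a \<Rightarrow> 'a \<Rightarrow> real"
  assumes X: "X \<noteq> {}"
    and cov1: "\<And>k. k < K \<Longrightarrow> coverable X d (2 ^ (2 ^ k)) (\<delta> k)"
    and cov2: "\<And>k. k \<ge> K \<Longrightarrow> coverable X d (2 ^ (2 ^ k)) (E / 2 ^ k)"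
    and D: "\<And>x y. x \<in> X \<Longrightarrow> y \<in> X \<Longrightarrow> d x y \<le> D"
    and nonneg: "D \<ge> 0" "E \<ge> 0" "\<And>k. \<delta> k \<ge> 0"
  shows "gamma2 X d \<le> ennreal (D + (\<Sum>k<K. sqrt 2 ^ Suc k * \<delta> k) + 5 * E / sqrt 2 ^ K)"
proof -
  define r where "r = sqrt (2::real)"
  have r2: "r * r = 2" and r0: "r > 0" by (auto simp: r_def)
  have r14: "r \<ge> 7 / 5" unfolding r_def by (rule real_le_rsqrt) (simp add: power2_eq_square)
  define \<delta>' where "\<delta>' k = (if k < K then \<delta> k else E / 2 ^ k)" for k
  define g where "g k = r ^ Suc k * \<delta>' k" for k
  have gK: "g (j + K) = (r * E / r ^ K) * (1 / r) ^ j" for j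
  proof -
    have "(2::real) ^ (j + K) = r ^ (j + K) * r ^ (j + K)" by (simp add: r2[symmetric] power_mult_distrib)
    thus ?thesis using r0 by (simp add: g_def \<delta>'_def power_add field_simps)
  qed
  have geo: "(\<lambda>j. (1 / r) ^ j) sums (1 / (1 - 1 / r))" using r14 by (intro geometric_sums) auto
  have tail: "(\<lambda>j. g (j + K)) sums ((r * E / r ^ K) * (1 / (1 - 1 / r)))"
    unfolding gK by (rule sums_mult[OF geo])
  hence summ: "summable g" using summable_iff_shift[of g K] sums_summable by blast
  have cov: "coverable X d (2 ^ (2 ^ k)) (\<delta>' k)" and \<delta>'0: "\<delta>' k \<ge> 0" for k
    using cov1 cov2 nonneg by (auto simp: \<delta>'_def)
  have "gamma2 X d \<le> ennreal (D + (\<Sum>k. g k))"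
    using gamma2_le_suminf[OF X cov D nonneg(1) \<delta>'0] summ unfolding g_def r_def by blast
  also have "(\<Sum>k. g k) = (\<Sum>k<K. g k) + (r * E / r ^ K) * (1 / (1 - 1 / r))"
    using suminf_split_initial_segment[OF summ, of K] sums_unique[OF tail] by simp
  also have "(\<Sum>k<K. g k) = (\<Sum>k<K. r ^ Suc k * \<delta> k)" by (intro sum.cong) (auto simp: g_def \<delta>'_def)
  finally have le: "gamma2 X d \<le> ennreal (D + ((\<Sum>k<K. r ^ Suc k * \<delta> k) + (r * E / r ^ K) * (1 / (1 - 1 / r))))" .
  \<comment> \<open>The left side equals \<open>2 / (r - 1)\<close>, and
    \<open>r \<ge> 7 / 5\<close> makes this at most 5.\<close>
  have "r * (1 / (1 - 1 / r)) \<le> 5" using r14 r2 by (simp add: field_simps)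
  hence "(E / r ^ K) * (r * (1 / (1 - 1 / r))) \<le> (E / r ^ K) * 5"
    by (rule mult_left_mono) (use nonneg r0 in simp)
  hence "(r * E / r ^ K) * (1 / (1 - 1 / r)) \<le> 5 * E / r ^ K" by (simp add: mult_ac)
  hence "ennreal (D + ((\<Sum>k<K. r ^ Suc k * \<delta> k) + (r * E / r ^ K) * (1 / (1 - 1 / r))))
      \<le> ennreal (D + (\<Sum>k<K. r ^ Suc k * \<delta> k) + 5 * E / r ^ K)"
    by (intro ennreal_leI) linarith
  thus ?thesis using le unfolding r_def by (rule order_trans[rotated])
qed

section \<open>The Toeplitz norm on the unit sphere\<close>

text \<open>Coefficients of the real and imaginary parts of the discrete Fourier transform of length
  \<open>3 * T\<close> at frequency \<open>m\<close>: the index is a position inside the blocks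
  together with the choice of \<open>cos\<close> or \<open>sin\<close>. Each frequency thus gives
  \<open>2 * p\<close> real linear forms, as the Gaussian bounds require.\<close>

definition freq_form :: "nat \<Rightarrow> nat \<Rightarrow> nat \<Rightarrow> nat \<times> bool \<Rightarrow> nat \<Rightarrow> real" where
  "freq_form T p m i k = (if k mod p = fst i then
     (if snd i then cos else sin) (2 * pi * real m * real (k div p) / real (3 * T)) else 0)"

lemma sum_residue_class:
  fixes f :: "nat \<Rightarrow> real"
  assumes "j < p"
  shows "(\<Sum>k<T * p. if k mod p = j then f k else 0) = (\<Sum>u<T. f (u * p + j))"
proof -
  have "(\<Sum>k<T * p. if k mod p = j then f k else 0)
      = (\<Sum>u<T. \<Sum>i<p. if (i + u * p) mod p = j then f (i + u * p) else 0)"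
    by (rule sum_mult_product)
  also have "\<dots> = (\<Sum>u<T. \<Sum>i<p. if i = j then f (i + u * p) else 0)"
    by (intro sum.cong refl) auto
  also have "\<dots> = (\<Sum>u<T. f (u * p + j))"
    using assms by (simp add: add.commute)
  finally show ?thesis .
qed

lemma freq_form_energy:
  fixes w :: "nat \<Rightarrow> real"
  shows "(\<Sum>i\<in>{..<p} \<times> UNIV. (\<Sum>k<T * p. freq_form T p m i k * w k)\<^sup>2)
       = (\<Sum>j<p. (cmod (\<Sum>u<T. complex_of_real (w (u * p + j)) * cis (2 * pi * real m * real u / real (3 * T))))\<^sup>2)"
proof -
  have form: "(\<Sum>k<T * p. freq_form T p m (j, b) k * w k)
      = (\<Sum>u<T. w (u * p + j) * (if b then cos else sin) (2 * pi * real m * real u / real (3 * T)))" if "j < p" for j b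
  proof -
    have "(\<Sum>k<T * p. freq_form T p m (j, b) k * w k)
        = (\<Sum>k<T * p. if k mod p = j then w k * (if b then cos else sin) (2 * pi * real m * real (k div p) / real (3 * T)) else 0)"
      by (intro sum.cong refl) (auto simp: freq_form_def)
    also have "\<dots> = (\<Sum>u<T. w (u * p + j) * (if b then cos else sin) (2 * pi * real m * real ((u * p + j) div p) / real (3 * T)))"
      by (rule sum_residue_class[OF that])
    finally show ?thesis using that by simp
  qed
  have "(\<Sum>i\<in>{..<p} \<times> UNIV. (\<Sum>k<T * p. freq_form T p m i k * w k)\<^sup>2)
      = (\<Sum>j<p. \<Sum>b\<in>UNIV. (\<Sum>k<T * p. freq_form T p m (j, b) k * w k)\<^sup>2)"
    by (simp add: sum.cartesian_product)
  also have "\<dots> = (\<Sum>j<p. (cmod (\<Sum>u<T. complex_of_real (w (u * p + j)) * cis (2 * pi * real m * real u / real (3 * T))))\<^sup>2)"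
    by (intro sum.cong refl) (simp add: UNIV_bool form cmod_power2)
  finally show ?thesis .
qed

lemma freq_form_variance:
  assumes "i \<in> {..<p} \<times> UNIV"
  shows "(\<Sum>k<T * p. (freq_form T p m i k)\<^sup>2) \<le> real T"
proof -
  have "(\<Sum>k<T * p. (freq_form T p m i k)\<^sup>2) \<le> (\<Sum>k<T * p. if k mod p = fst i then 1 else 0)"
    by (intro sum_mono) (auto simp: freq_form_def abs_square_le_1)
  also have "\<dots> = real T" using assms by (subst sum_residue_class) auto
  finally show ?thesis .
qed

lemma toep_norm_le_freq_form:
  assumes T: "T \<ge> 1" and p: "p \<ge> 1" and B: "B \<ge> 0"
    and le: "\<And>m. m < 3 * T \<Longrightarrow> (\<Sum>i\<in>{..<p} \<times> UNIV. (\<Sum>k<T * p. freq_form T p m i k * w k)\<^sup>2) \<le> B"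
  shows "toep_norm T p R w \<le> sqrt (2 * B)"
proof -
  have "toep_norm T p R w \<le> sqrt 2 * sqrt B"
    using le B by (intro toep_norm_le_spectral[OF T p]) (simp_all add: freq_form_energy)
  thus ?thesis by (simp add: real_sqrt_mult)
qed

lemma toep_norm_le_l2:
  assumes T: "T \<ge> 1" and p: "p \<ge> 1"
  shows "toep_norm T p R w \<le> sqrt (2 * real T) * sqrt (\<Sum>k<T * p. (w k)\<^sup>2)"
proof -
  have "toep_norm T p R w \<le> sqrt (2 * (real T * (\<Sum>k<T * p. (w k)\<^sup>2)))"
  proof (rule toep_norm_le_freq_form[OF T p])
    fix m
    show "(\<Sum>i\<in>{..<p} \<times> UNIV. (\<Sum>k<T * p. freq_form T p m i k * w k)\<^sup>2) \<le> real T * (\<Sum>k<T * p. (w k)\<^sup>2)"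
      using spectral_energy_le[of w p "2 * pi * real m / real (3 * T)" T] by (simp add: freq_form_energy)
  qed (simp add: sum_nonneg)
  thus ?thesis by (simp only: real_sqrt_mult mult.assoc)
qed

lemma unit_sphere_l2_diameter:
  assumes "x \<in> unit_sphere N" "y \<in> unit_sphere N"
  shows "sqrt (\<Sum>k<N. (x k - y k)\<^sup>2) \<le> 2"
proof -
  have "(\<Sum>k<N. (x k - y k)\<^sup>2) \<le> (\<Sum>k<N. 2 * (x k)\<^sup>2 + 2 * (y k)\<^sup>2)"
    by (intro sum_mono square_diff_le)
  also have "\<dots> = 2\<^sup>2"
    using assms by (simp add: unit_sphere_def sum.distrib sum_distrib_left[symmetric])
  finally show ?thesis by (intro real_le_lsqrt sum_nonneg) auto
qed

lemma toep_norm_diameter: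
  assumes "T \<ge> 1" "p \<ge> 1" "x \<in> unit_sphere (T * p)" "y \<in> unit_sphere (T * p)"
  shows "toep_norm T p R (\<lambda>k. x k - y k) \<le> 2 * sqrt (2 * real T)"
proof -
  have "toep_norm T p R (\<lambda>k. x k - y k) \<le> sqrt (2 * real T) * sqrt (\<Sum>k<T * p. (x k - y k)\<^sup>2)"
    by (rule toep_norm_le_l2[OF assms(1,2)])
  also have "\<dots> \<le> sqrt (2 * real T) * 2"
    by (intro mult_left_mono unit_sphere_l2_diameter assms) simp
  finally show ?thesis by simp
qed

lemma coverable_toep_volumetric:
  assumes T: "T \<ge> 1" and p: "p \<ge> 1" and k: "4 * (T * p) \<le> 2 ^ k"
  shows "coverable (unit_sphere (T * p)) (\<lambda>u v. toep_norm T p R (\<lambda>k. u k - v k)) (2 ^ (2 ^ k))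
     (4 * sqrt (2 * real T) * real (T * p) / 2 ^ k)"
proof (rule coverable_mono[OF coverable_unit_sphere_l2[OF _ k]])
  show "1 \<le> T * p" using T p by simp
  fix x y assume le: "sqrt (\<Sum>i<T * p. (x i - y i)\<^sup>2) \<le> 4 * real (T * p) / 2 ^ k"
  have "toep_norm T p R (\<lambda>k. x k - y k) \<le> sqrt (2 * real T) * sqrt (\<Sum>i<T * p. (x i - y i)\<^sup>2)"
    by (rule toep_norm_le_l2[OF T p])
  also have "\<dots> \<le> sqrt (2 * real T) * (4 * real (T * p) / 2 ^ k)"
    by (intro mult_left_mono le) simp
  finally show "toep_norm T p R (\<lambda>k. x k - y k) \<le> 4 * sqrt (2 * real T) * real (T * p) / 2 ^ k"
    by (simp add: mult_ac)
qed

text \<open>It converts the exponential count of dual Sudakov into \<open>2 ^ (2 ^ k)\<close>. The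
  inequality is false for \<open>n = 1\<close>, so level \<open>k = 0\<close> has to be treated
  apart.\<close>

lemma two_exp_quarter_le:
  assumes "n \<ge> 2"
  shows "2 * exp (real n / 4) \<le> 2 ^ n"
proof -
  have "real n / 4 \<le> (2 / 3) * (real n - 1)" using assms by simp
  also have "\<dots> \<le> ln 2 * (real n - 1)"
    using assms ln2_ge_two_thirds by (intro mult_right_mono) auto
  finally have "exp (real n / 4) \<le> exp (ln 2 * (real n - 1))" by simp
  also have "\<dots> = 2 powr (real n - 1)" by (simp add: powr_def mult.commute)
  also have "\<dots> = 2 ^ n / 2" by (simp add: powr_diff powr_realpow)
  finally show ?thesis by simp
qed

text \<open>\<open>B\<close> is the Gaussian threshold for \<open>3 * T\<close> seminorms made of
  \<open>2 * p\<close> forms of variance at most \<open>T\<close>: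
  \<open>2 * (2 * p) * T * ln (4 * (3 * T))\<close>.\<close>

lemma coverable_toep_dual_sudakov:
  assumes T: "T \<ge> 1" and p: "p \<ge> 1"
    and B: "B = 4 * real (T * p) * ln (12 * real T)"
  shows "coverable (unit_sphere (T * p)) (\<lambda>u v. toep_norm T p R (\<lambda>k. u k - v k)) (2 ^ (2 ^ k)) (8 * sqrt B / sqrt 2 ^ k)"
proof (cases "k = 0")
  \<comment> \<open>At level 0 the diameter \<open>2 * sqrt (2 * T)\<close> already suffices,
    because \<open>ln (12 * T) \<ge> 1\<close>.\<close>
  case True
  have "exp 1 \<le> 12 * real T" using T exp_le by linarith
  hence "1 \<le> ln (12 * real T)" using T ln_ge_iff[of "12 * real T" 1] by simp
  hence "real T * (1 * 1) \<le> real T * (real p * ln (12 * real T))"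
    using p by (intro mult_left_mono mult_mono) auto
  hence "2 * real T \<le> B" using B T by simp
  hence "2 * sqrt (2 * real T) \<le> 8 * sqrt B"
    by (intro mult_mono) (use B in auto)
  hence diam_le: "2 * sqrt (2 * real T) \<le> 8 * sqrt B / sqrt 2 ^ k" by (simp add: True)
  show ?thesis
    by (rule coverable_trivial, simp, rule order_trans[OF toep_norm_diameter[OF T p] diam_le])
next
  case False
  \<comment> \<open>This makes the exponent \<open>2 * B / D\<close> equal to
    \<open>2 ^ k / 4\<close>.\<close>
  define D where "D = 8 * B / 2 ^ k"
  have B0: "B > 0" unfolding B using T p by (intro mult_pos_pos ln_gt_zero) auto
  have D0: "D > 0" using B0 by (simp add: D_def)
  define near where "near x y \<longleftrightarrow>
    (\<forall>m\<in>{..<3*T}. (\<Sum>i\<in>{..<p} \<times> UNIV. (\<Sum>k<T * p. freq_form T p m i k * (x k - y k))\<^sup>2) \<le> D)" for x y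
  show ?thesis
  proof (rule coverable_if_separated_card_le[of _ near])
    fix x show "near x x" using D0 by (simp add: near_def)
  next
    fix x y assume "near x y"
    moreover have "(\<Sum>k<T * p. freq_form T p m i k * (y k - x k))\<^sup>2 = (\<Sum>k<T * p. freq_form T p m i k * (x k - y k))\<^sup>2" for m i
      by (subst power2_minus[symmetric]) (simp add: sum_negf[symmetric] algebra_simps)
    ultimately show "near y x" by (simp add: near_def)
  next
    fix S :: "(nat \<Rightarrow> real) set"
    assume S: "finite S" "S \<subseteq> unit_sphere (T * p)" and sep: "\<And>x y. x \<in> S \<Longrightarrow> y \<in> S \<Longrightarrow> x \<noteq> y \<Longrightarrow> \<not> near x y"
    have "real (card S) \<le> 2 * exp (2 * B / D)"
    proof (rule dual_sudakov_separated_card_le[where Q="{..<3*T}" and I="{..<p} \<times> UNIV"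
          and a="freq_form T p" and N="T * p" and \<sigma>="real T"])
      show "B = 2 * real (card ({..<p} \<times> (UNIV :: bool set))) * real T * ln (4 * real (card {..<3 * T}))"
        by (simp add: B card_cartesian_product mult_ac)
      fix x assume "x \<in> S"
      thus "(\<Sum>k<T * p. (x k)\<^sup>2) \<le> 1" using S(2) by (auto simp: unit_sphere_def)
    next
      fix x y assume "x \<in> S" "y \<in> S" "x \<noteq> y"
      thus "\<exists>m\<in>{..<3 * T}. (\<Sum>i\<in>{..<p} \<times> UNIV. (\<Sum>k<T * p. freq_form T p m i k * (x k - y k))\<^sup>2) > D"
        using sep[of x y] by (auto simp: near_def not_le)
    qed (use T p D0 S(1) freq_form_variance in \<open>auto simp: lessThan_empty_iff\<close>)
    also have "2 * B / D = real (2 ^ k) / 4" using B0 by (simp add: D_def)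
    also have "2 * exp (real (2 ^ k) / 4) \<le> 2 ^ (2 ^ k)"
      using False by (intro two_exp_quarter_le) (cases k, auto)
    finally show "card S \<le> 2 ^ (2 ^ k)" by (metis of_nat_le_iff of_nat_numeral of_nat_power)
  next
    fix x y z assume near: "near x z" "near y z"
    \<comment> \<open>Two points near the same centre differ by an energy of at most
      \<open>4 * D\<close> at each frequency; the inner factor 2 is the loss of the spectral
      bound.\<close>
    have "toep_norm T p R (\<lambda>k. x k - y k) \<le> sqrt (2 * (4 * D))"
    proof (rule toep_norm_le_freq_form[OF T p])
      fix m assume m: "m < 3 * T"
      define a where "a i = (\<Sum>k<T * p. freq_form T p m i k * (x k - z k))" for i
      define b where "b i = (\<Sum>k<T * p. freq_form T p m i k * (y k - z k))" for i
      have ab: "(\<Sum>k<T * p. freq_form T p m i k * (x k - y k)) = a i - b i" for i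
        by (simp add: a_def b_def sum_subtractf[symmetric] algebra_simps)
      have "(\<Sum>i\<in>{..<p} \<times> UNIV. (a i)\<^sup>2) \<le> D" "(\<Sum>i\<in>{..<p} \<times> UNIV. (b i)\<^sup>2) \<le> D"
        using near m by (auto simp: near_def a_def b_def)
      moreover have "(\<Sum>i\<in>{..<p} \<times> UNIV. (a i - b i)\<^sup>2) \<le> (\<Sum>i\<in>{..<p} \<times> UNIV. 2 * (a i)\<^sup>2 + 2 * (b i)\<^sup>2)"
        by (intro sum_mono square_diff_le)
      ultimately show "(\<Sum>i\<in>{..<p} \<times> UNIV. (\<Sum>k<T * p. freq_form T p m i k * (x k - y k))\<^sup>2) \<le> 4 * D"
        unfolding ab by (simp add: sum.distrib sum_distrib_left[symmetric])
    qed (use D0 in simp)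
    also have "2 * (4 * D) = 8\<^sup>2 * (B / 2 ^ k)" by (simp add: D_def)
    also have "sqrt \<dots> = 8 * sqrt B / sqrt 2 ^ k"
      by (simp only: real_sqrt_mult real_sqrt_divide real_sqrt_power) simp
    finally show "toep_norm T p R (\<lambda>k. x k - y k) \<le> 8 * sqrt B / sqrt 2 ^ k" .
  qed
qed

section \<open>The two bounds for the sphere\<close>

lemma obtain_two_power_bracket:
  fixes M :: nat
  assumes "M \<ge> 2"
  obtains K where "M \<le> 2 ^ K" "2 ^ K \<le> 2 * M"
proof -
  define K where "K = (LEAST K. M \<le> 2 ^ K)"
  have "M \<le> 2 ^ M" using less_exp[of M] by simp
  hence 1: "M \<le> 2 ^ K" unfolding K_def by (rule LeastI)
  hence "K \<noteq> 0" using assms by (intro notI) simp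
  then obtain J where J: "K = Suc J" by (cases K) auto
  have "\<not> M \<le> 2 ^ J" using not_less_Least[of J "\<lambda>K. M \<le> 2 ^ K"] J by (simp add: K_def)
  thus ?thesis using 1 by (intro that[of K]) (auto simp: J)
qed

lemma unit_sphere_nonempty:
  assumes "N \<ge> 1"
  shows "unit_sphere N \<noteq> {}"
proof -
  have "(\<lambda>k. if k = 0 then 1 else 0) \<in> unit_sphere N"
    using assms by (auto simp: unit_sphere_def if_distrib[of "\<lambda>x. x\<^sup>2"] cong: if_cong)
  thus ?thesis by blast
qed

text \<open>Below \<open>2 ^ K ~ N\<close> the diameter serves at every level. The partial sums of
  \<open>sqrt 2 ^ k\<close> are then dominated by \<open>sqrt 2 ^ K ~ sqrt N\<close>, and the
  lattice tail has the same order \<open>sqrt T * sqrt N\<close>.\<close>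

lemma gamma2_toep_le_trivial:
  assumes T: "T \<ge> 1" and p: "p \<ge> 1"
  shows "gamma2 (unit_sphere (T * p)) (\<lambda>u v. toep_norm T p R (\<lambda>k. u k - v k))
       \<le> ennreal (167 * sqrt (real T * (real p * real T)))"
proof -
  define N where "N = T * p"
  have N: "N \<ge> 1" using T p by (simp add: N_def)
  define s where "s = sqrt (real N)"
  define t where "t = sqrt (2 * real T)"
  have s2: "s * s = real N" and s1: "s \<ge> 1" using N by (auto simp: s_def)
  have t0: "t \<ge> 0" by (simp add: t_def)
  obtain K where K: "4 * N \<le> 2 ^ K" "2 ^ K \<le> 2 * (4 * N)"
    using obtain_two_power_bracket[of "4 * N"] N by auto
  define q where "q = sqrt 2 ^ K"
  have q: "q = sqrt (2 ^ K)" by (simp add: q_def real_sqrt_power)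
  \<comment> \<open>\<open>2 ^ K \<le> 8 * N \<le> 9 * N\<close>.\<close>
  have q_le: "q \<le> 3 * s"
  proof -
    have "real (2 ^ K) \<le> real (2 * (4 * N))" using K(2) by (rule of_nat_mono)
    hence "(2::real) ^ K \<le> (3 * s)\<^sup>2" using N by (simp add: power2_eq_square s2)
    thus ?thesis unfolding q using s1 by (intro real_le_lsqrt) auto
  qed
  have q_ge: "2 * s \<le> q"
  proof -
    have "real (4 * N) \<le> real (2 ^ K)" using K(1) by (rule of_nat_mono)
    hence "(2 * s)\<^sup>2 \<le> 2 ^ K" by (simp add: power2_eq_square s2)
    thus ?thesis unfolding q by (rule real_le_rsqrt)
  qed
  have r: "sqrt 2 \<ge> 7 / 5" by (rule real_le_rsqrt) (simp add: power2_eq_square)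
  have "gamma2 (unit_sphere N) (\<lambda>u v. toep_norm T p R (\<lambda>k. u k - v k))
      \<le> ennreal (2 * t + (\<Sum>k<K. sqrt 2 ^ Suc k * (2 * t)) + 5 * (4 * t * real N) / sqrt 2 ^ K)"
  proof (rule gamma2_le_split)
    show "unit_sphere N \<noteq> {}" by (rule unit_sphere_nonempty[OF N])
    show diam: "toep_norm T p R (\<lambda>k. x k - y k) \<le> 2 * t" if "x \<in> unit_sphere N" "y \<in> unit_sphere N" for x y
      using toep_norm_diameter[OF T p] that by (simp add: N_def t_def)
    show "coverable (unit_sphere N) (\<lambda>u v. toep_norm T p R (\<lambda>k. u k - v k)) (2 ^ 2 ^ k) (2 * t)" for k
      using diam by (intro coverable_trivial) auto
    show "coverable (unit_sphere N) (\<lambda>u v. toep_norm T p R (\<lambda>k. u k - v k)) (2 ^ 2 ^ k) (4 * t * real N / 2 ^ k)" if "K \<le> k" for k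
    proof -
      have "(2::nat) ^ K \<le> 2 ^ k" using that by simp
      hence "4 * (T * p) \<le> 2 ^ k" using K(1) unfolding N_def by linarith
      thus ?thesis using coverable_toep_volumetric[OF T p] by (simp add: N_def t_def)
    qed
  qed (use t0 in auto)
  also have "\<dots> \<le> ennreal (167 * sqrt (real T * (real p * real T)))"
  proof (rule ennreal_leI)
    have "(\<Sum>k<K. sqrt 2 ^ Suc k * (2 * t)) = (sqrt 2 * (2 * t)) * (\<Sum>k<K. sqrt 2 ^ k)"
      by (simp add: sum_distrib_left mult_ac)
    also have "(\<Sum>k<K. sqrt 2 ^ k) = (q - 1) / (sqrt 2 - 1)" by (simp add: geometric_sum q_def)
    also have "(sqrt 2 * (2 * t)) * ((q - 1) / (sqrt 2 - 1)) = (2 * t) * (q - 1) * (sqrt 2 / (sqrt 2 - 1))" by simp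
    also have "\<dots> \<le> (2 * t) * (q - 1) * 4"
    proof (rule mult_left_mono)
      show "sqrt 2 / (sqrt 2 - 1) \<le> 4" using r by (simp add: field_simps)
      show "0 \<le> (2 * t) * (q - 1)" using q_ge s1 t0 by (intro mult_nonneg_nonneg) linarith+
    qed
    also have "\<dots> \<le> (2 * t) * (3 * s) * 4"
      using q_le t0 by (intro mult_right_mono mult_left_mono) auto
    finally have 1: "(\<Sum>k<K. sqrt 2 ^ Suc k * (2 * t)) \<le> 24 * (t * s)" by (simp add: mult_ac)
    have "5 * (4 * t * real N) / sqrt 2 ^ K \<le> 5 * (4 * t * real N) / (2 * s)"
      unfolding q_def[symmetric] using q_ge s1 t0 by (intro divide_left_mono) auto
    also have "\<dots> = 10 * (t * s)" using s1 by (simp add: s2[symmetric])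
    finally have 2: "5 * (4 * t * real N) / sqrt 2 ^ K \<le> 10 * (t * s)" .
    have 3: "2 * t \<le> 2 * (t * s)" using mult_left_mono[OF s1 t0] by simp
    have "t * s = sqrt 2 * sqrt (real T * (real p * real T))"
      by (simp add: t_def s_def N_def real_sqrt_mult mult_ac)
    also have "\<dots> \<le> 2 * sqrt (real T * (real p * real T))"
      by (intro mult_right_mono real_le_lsqrt) auto
    finally have 4: "t * s \<le> 2 * sqrt (real T * (real p * real T))" .
    have "0 \<le> sqrt (real T * (real p * real T))" by simp
    thus "2 * t + (\<Sum>k<K. sqrt 2 ^ Suc k * (2 * t)) + 5 * (4 * t * real N) / sqrt 2 ^ K
        \<le> 167 * sqrt (real T * (real p * real T))"
      using 1 2 3 4 by linarith
  qed
  finally show ?thesis by (simp add: N_def)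
qed

lemma gamma2_toep_le_log:
  assumes T: "T \<ge> 1" and p: "p \<ge> 1"
  defines "l \<equiv> ln (exp 1 * real T * real p)" and "L \<equiv> ln (exp 1 * real T)"
  shows "gamma2 (unit_sphere (T * p)) (\<lambda>u v. toep_norm T p R (\<lambda>k. u k - v k))
       \<le> ennreal (167 * sqrt (real T * (real p * (l\<^sup>2 * L\<^sup>2))))"
proof -
  define N where "N = T * p"
  have N: "N \<ge> 1" using T p by (simp add: N_def)
  define B where "B = 4 * real (T * p) * ln (12 * real T)"
  define t where "t = sqrt (2 * real T)"
  define s where "s = sqrt (real N)"
  have t0: "t \<ge> 0" by (simp add: t_def)
  have l: "l = 1 + ln (real N)" and l1: "l \<ge> 1"
    using T p by (simp_all add: l_def N_def ln_mult)
  have L: "L = 1 + ln (real T)" and L1: "L \<ge> 1"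
    using T by (simp_all add: L_def ln_mult)
  \<comment> \<open>Going up to the square of \<open>N\<close> gives
    \<open>sqrt 2 ^ K \<ge> 2 * N\<close>, which cancels the factor \<open>N\<close> of the lattice
    radius; \<open>K\<close> remains at most \<open>3 * l\<close>.\<close>
  obtain K where K: "4 * N\<^sup>2 \<le> 2 ^ K" "2 ^ K \<le> 2 * (4 * N\<^sup>2)"
    using obtain_two_power_bracket[of "4 * N\<^sup>2"] N by auto
  have K_le: "real K \<le> 3 * l"
  proof -
    have "real (2 ^ K) \<le> real (2 * (4 * N\<^sup>2))" using K(2) by (rule of_nat_mono)
    hence "ln ((2::real) ^ K) \<le> ln (2 ^ 3 * (real N)\<^sup>2)"
      using N by (subst ln_le_cancel_iff) auto
    hence "real K * ln 2 \<le> 3 * ln 2 + 2 * ln (real N)"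
      using N ln_realpow[of 2 3] by (simp add: ln_mult ln_realpow)
    moreover have "2 * ln (real N) \<le> (3 * ln (real N)) * ln 2"
      using mult_left_mono[OF ln2_ge_two_thirds, of "3 * ln (real N)"] N by simp
    ultimately have "real K * ln 2 \<le> (3 * l) * ln 2" by (simp add: l algebra_simps)
    thus ?thesis by simp
  qed
  have q_ge: "2 * real N \<le> sqrt 2 ^ K"
  proof -
    have "real (4 * N\<^sup>2) \<le> real (2 ^ K)" using K(1) by (rule of_nat_mono)
    hence "(2 * real N)\<^sup>2 \<le> 2 ^ K" by (simp add: power_mult_distrib)
    hence "2 * real N \<le> sqrt (2 ^ K)" by (rule real_le_rsqrt)
    thus ?thesis by (simp add: real_sqrt_power)
  qed
  have B_le: "sqrt B \<le> 4 * s * L"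
  proof -
    have "ln (12 * real T) = ln 3 + 2 * ln 2 + ln (real T)"
    proof -
      have "12 * real T = 3 * (2 * 2) * real T" by simp
      thus ?thesis using T by (simp only: ln_mult) simp
    qed
    also have "\<dots> \<le> 4 + ln (real T)" using ln_le_minus_one[of "3::real"] ln_le_minus_one[of "2::real"] by simp
    also have "\<dots> \<le> 4 * L" using T by (simp add: L)
    \<comment> \<open>A deliberate loss: dual Sudakov costs only \<open>sqrt L\<close>, but the
      claimed bound allows a full factor \<open>L\<close>.\<close>
    also have "\<dots> \<le> 4 * L\<^sup>2" using L1 by (simp add: power2_eq_square)
    finally have "B \<le> 4 * real N * (4 * L\<^sup>2)" unfolding B_def N_def by (intro mult_left_mono) auto
    also have "\<dots> = (4 * s * L)\<^sup>2" using N by (simp add: s_def power_mult_distrib)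
    finally show ?thesis using L1 by (intro real_le_lsqrt) (auto simp: s_def)
  qed
  have B0: "B \<ge> 0" unfolding B_def using T by (intro mult_nonneg_nonneg ln_ge_zero) auto
  have "gamma2 (unit_sphere N) (\<lambda>u v. toep_norm T p R (\<lambda>k. u k - v k))
      \<le> ennreal (2 * t + (\<Sum>k<K. sqrt 2 ^ Suc k * (8 * sqrt B / sqrt 2 ^ k)) + 5 * (4 * t * real N) / sqrt 2 ^ K)"
  proof (rule gamma2_le_split)
    show "unit_sphere N \<noteq> {}" by (rule unit_sphere_nonempty[OF N])
    show "toep_norm T p R (\<lambda>k. x k - y k) \<le> 2 * t" if "x \<in> unit_sphere N" "y \<in> unit_sphere N" for x y
      using toep_norm_diameter[OF T p] that by (simp add: N_def t_def)
    show "coverable (unit_sphere N) (\<lambda>u v. toep_norm T p R (\<lambda>k. u k - v k)) (2 ^ 2 ^ k) (8 * sqrt B / sqrt 2 ^ k)" for k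
      unfolding N_def by (rule coverable_toep_dual_sudakov[OF T p B_def])
    show "coverable (unit_sphere N) (\<lambda>u v. toep_norm T p R (\<lambda>k. u k - v k)) (2 ^ 2 ^ k) (4 * t * real N / 2 ^ k)" if "K \<le> k" for k
    proof -
      have "(2::nat) ^ K \<le> 2 ^ k" using that by simp
      moreover have "4 * N \<le> 4 * N\<^sup>2" by (simp add: power2_eq_square)
      ultimately have "4 * (T * p) \<le> 2 ^ k" using K(1) unfolding N_def by linarith
      thus ?thesis using coverable_toep_volumetric[OF T p] by (simp add: N_def t_def)
    qed
  qed (use t0 B0 in auto)
  also have "\<dots> \<le> ennreal (167 * sqrt (real T * (real p * (l\<^sup>2 * L\<^sup>2))))"
  proof (rule ennreal_leI)
    have r: "sqrt 2 \<le> 3 / 2" by (rule real_le_lsqrt) (auto simp: power2_eq_square)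
    have s0: "s \<ge> 0" by (simp add: s_def)
    have lL1: "l * L \<ge> 1" using mult_mono[OF l1 L1] l1 by simp
    \<comment> \<open>The powers of \<open>sqrt 2\<close> cancel, so all \<open>K\<close> levels
      contribute the same amount.\<close>
    have "(\<Sum>k<K. sqrt 2 ^ Suc k * (8 * sqrt B / sqrt 2 ^ k)) = real K * (sqrt 2 * (8 * sqrt B))"
      by simp
    also have "\<dots> \<le> (3 * l) * ((3 / 2) * (8 * (4 * s * L)))"
      using K_le r B_le B0 l1 by (intro mult_mono) auto
    finally have 1: "(\<Sum>k<K. sqrt 2 ^ Suc k * (8 * sqrt B / sqrt 2 ^ k)) \<le> 144 * (s * (l * L))" by (simp add: mult_ac)
    have "5 * (4 * t * real N) / sqrt 2 ^ K \<le> 5 * (4 * t * real N) / (2 * real N)"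
      using q_ge t0 N by (intro divide_left_mono mult_pos_pos) auto
    also have "\<dots> = 10 * t" using N by simp
    finally have 2: "5 * (4 * t * real N) / sqrt 2 ^ K \<le> 10 * t" .
    have "t = sqrt 2 * sqrt (real T)" by (simp add: t_def real_sqrt_mult)
    also have "\<dots> \<le> (3 / 2) * s"
      using r p by (intro mult_mono) (auto simp: s_def N_def mult_le_cancel_left1)
    also have "\<dots> \<le> (3 / 2) * (s * (l * L))"
      using mult_left_mono[OF lL1 s0] by simp
    finally have 3: "t \<le> (3 / 2) * (s * (l * L))" .
    have 4: "sqrt (real T * (real p * (l\<^sup>2 * L\<^sup>2))) = s * (l * L)"
      using l1 L1 by (simp add: s_def N_def real_sqrt_mult mult_ac)
    \<comment> \<open>The contributions add up to \<open>144 + 12 * (3 / 2) = 162\<close> times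
      \<open>s * (l * L)\<close>; the constant 167 leaves some slack.\<close>
    show "2 * t + (\<Sum>k<K. sqrt 2 ^ Suc k * (8 * sqrt B / sqrt 2 ^ k)) + 5 * (4 * t * real N) / sqrt 2 ^ K
        \<le> 167 * sqrt (real T * (real p * (l\<^sup>2 * L\<^sup>2)))"
      unfolding 4 using 1 2 3 mult_nonneg_nonneg[OF s0, of "l * L"] lL1 by linarith
  qed
  finally show ?thesis by (simp add: N_def)
qed

theorem proposition7:
  shows "\<exists>C::real. C > 0 \<and> (\<forall>T p R :: nat. T \<ge> 1 \<longrightarrow> p \<ge> 1 \<longrightarrow> R \<ge> 1 \<longrightarrow>
     gamma2 (unit_sphere (T * p)) (\<lambda>u v. toep_norm T p R (\<lambda>k. u k - v k))
       \<le> ennreal (C * sqrt (real T * (real p *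
            min (real T) ((ln (exp 1 * real T * real p))^2 * (ln (exp 1 * real T))^2)))))"
\<comment> \<open>Both bounds are stated with the same constant 167, so the minimum is a case
  distinction.\<close>
proof (intro exI[of _ 167] conjI allI impI)
  fix T p R :: nat
  assume T: "T \<ge> 1" and p: "p \<ge> 1"
  show "gamma2 (unit_sphere (T * p)) (\<lambda>u v. toep_norm T p R (\<lambda>k. u k - v k))
       \<le> ennreal (167 * sqrt (real T * (real p *
            min (real T) ((ln (exp 1 * real T * real p))^2 * (ln (exp 1 * real T))^2))))"
    using gamma2_toep_le_trivial[OF T p, of R] gamma2_toep_le_log[OF T p, of R] by (simp add: min_def)
qed simp

end
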